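(* Let $G$ be an H-type group with underlying manifold $\mathbb{R}^{2n+m}$, where $m>1$ is the dimension of the center. The range $1\le p\le\frac{2m+2}{m+3}$ in the restriction theorem associated with the full Laplacian $\Delta=L+T$ is sharp: if $1\le p\le 2$, $\frac1p+\frac1{p'}=1$, and for every $\mu>0$ there is a finite constant $C_\mu$ such that $$\|\mathcal{P}_\mu^\Delta f\|_{L^{p'}(G)}\le C_\mu\|f\|_{L^p(G)}$$ for all Schwartz functions $f$ on $G$, then $p\le\frac{2m+2}{m+3}$.
   Context: H-type group: let $\mathfrak g$ be a (finite-dimensional real) two-step nilpotent Lie algebra with inner product $\langle\cdot,\cdot\rangle$, center $\mathfrak z$, and orthogonal complement $\mathfrak z^\perp$. It is of H-type if $[\mathfrak z^\perp,\mathfrak z^\perp]=\mathfrak z$ and, for every $t\in\mathfrak z$, the map $J_t:\mathfrak z^\perp\to\mathfrak z^\perp$ defined by $\langle J_tu,w\rangle=\langle t,[u,w]\rangle$ for all $u,w\in\mathfrak z^\perp$ is orthogonal whenever $|t|=1$. An H-type group is a connected, simply connected Lie group $G$ whose Lie algebra is of H-type. Write $\dim\mathfrak z^\perp=2n$ (it is necessarily even) and $\dim\mathfrak z=m$. Via the exponential map and orthonormal bases, $G$ is identified with $\mathbb{R}^{2n}\times\mathbb{R}^m\ni(z,t)$, with group law $(z,t)(z',t')=(z+z',t+t'+\frac12[z,z'])$. Haar measure is Lebesgue measure $dz\,dt$, Schwartz functions on $G$ are those on $\mathbb{R}^{2n+m}$, and $f*g(x)=\int_G f(y)g(y^{-1}x)\,dy$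 is group convolution. For $0\neq a\in\mathfrak z^*\cong\mathfrak z\cong\mathbb{R}^m$ and $k=0,1,2,\dots$ put $$e_k^a(z,t)=e^{-i\langle a,t\rangle}\varphi_k^{|a|}(z),\qquad \varphi_k^\lambda(z)=L_k^{n-1}\left(\tfrac12\lambda|z|^2\right)e^{-\frac14\lambda|z|^2}\quad(\lambda>0),$$ where $L_k^{n-1}$ is the Laguerre polynomial of type $n-1$ and degree $k$. Let $L=-\sum_{j=1}^{n}(X_j^2+Y_j^2)$ be the sublaplacian, where $X_j,Y_j$ are the left-invariant vector fields agreeing at the origin with $\partial/\partial x_j,\partial/\partial y_j$ (coordinates $z=(x,y)$ with respect to an orthonormal basis of $\mathfrak z^\perp$), $T=-\sum_{k=1}^m\partial^2/\partial t_k^2$, and $\Delta=L+T$ the full Laplacian. The function $f*e_k^a$ is a joint eigenfunction of $L$ and $T$ with eigenvalues $(2k+n)|a|$ and $|a|^2$. Restriction operator $\mathcal{P}_\mu^\Delta=\delta_\mu(\Delta)$: for $\mu>0$ let $\lambda_k(\mu)=\frac12\sqrt{4\mu+(2k+n)^2}-\frac{2k+n}{2}$, i.e. the positive solution of $(2k+n)\lambda+\lambda^2=\mu$, with derivative $\lambda_k'(\mu)=\frac{1}{\sqrt{4\mu+(2k+n)^2}}$. For a Schwartz function $f$, $$\mathcal{P}_\mu^\Delta f(z,t)=\frac{1}{(2\pi)^{n+m}}\sum_{k=0}^\infty\lambda_k(\mu)^{n+m-1}\lambda_k'(\mu)\int_{S^{m-1}}f*e_k^{\lambda_k(\mu)\tilde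 a}(z,t)\,d\sigma(\tilde a),$$ where $d\sigma$ is the surface measure on the unit sphere $S^{m-1}\subset\mathbb{R}^m$. *)

theory Defs
  imports "HOL-Probability.Probability"
begin

section \<open>H-type Lie algebras\<close>

definition lie_bracket :: "('g::euclidean_space \<Rightarrow> 'g \<Rightarrow> 'g) \<Rightarrow> bool" where
  "lie_bracket br \<longleftrightarrow> bilinear br \<and> (\<forall>x. br x x = 0) \<and>
     (\<forall>x y z. br x (br y z) + br y (br z x) + br z (br x y) = 0)"

definition two_step_nilpotent :: "('g::euclidean_space \<Rightarrow> 'g \<Rightarrow> 'g) \<Rightarrow> bool" where
  "two_step_nilpotent br \<longleftrightarrow> (\<forall>x y z. br (br x y) z = 0) \<and> (\<exists>x y. br x y \<noteq> 0)"

definition lie_center :: "('g::euclidean_space \<Rightarrow> 'g \<Rightarrow> 'g) \<Rightarrow> 'g set" where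
  "lie_center br = {x. \<forall>y. br x y = 0}"

text \<open>For a bilinear \<open>br\<close> the vector \<open>v\<close> below exists and is unique, because the
  functional \<open>w \<mapsto> \<langle>t, [u,w]\<rangle>\<close> on the orthogonal complement of the
  center is represented by exactly one vector of that complement.\<close>

definition J_map :: "('g::euclidean_space \<Rightarrow> 'g \<Rightarrow> 'g) \<Rightarrow> 'g \<Rightarrow> 'g \<Rightarrow> 'g" where
  "J_map br t u = (THE v. v \<in> (lie_center br)\<^sup>\<bottom> \<and>
     (\<forall>w \<in> (lie_center br)\<^sup>\<bottom>. v \<bullet> w = t \<bullet> br u w))"

definition H_type :: "('g::euclidean_space \<Rightarrow> 'g \<Rightarrow> 'g) \<Rightarrow> bool" where
  "H_type br \<longleftrightarrow> lie_bracket br \<and> two_step_nilpotent br \<and>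
     span {br u w | u w. u \<in> (lie_center br)\<^sup>\<bottom> \<and> w \<in> (lie_center br)\<^sup>\<bottom>} = lie_center br \<and>
     (\<forall>t \<in> lie_center br. norm t = 1 \<longrightarrow>
        (\<forall>u \<in> (lie_center br)\<^sup>\<bottom>. \<forall>w \<in> (lie_center br)\<^sup>\<bottom>. J_map br t u \<bullet> J_map br t w = u \<bullet> w))"

section \<open>The group in exponential coordinates\<close>

text \<open>The connected, simply connected group is the Lie algebra itself with the
  Baker--Campbell--Hausdorff product; the inverse of \<open>y\<close> is \<open>- y\<close>.\<close>

definition gmult :: "('g::euclidean_space \<Rightarrow> 'g \<Rightarrow> 'g) \<Rightarrow> 'g \<Rightarrow> 'g \<Rightarrow> 'g" where
  "gmult br x y = x + y + (1/2) *\<^sub>R br x y"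

definition gconv :: "('g::euclidean_space \<Rightarrow> 'g \<Rightarrow> 'g) \<Rightarrow> ('g \<Rightarrow> complex) \<Rightarrow> ('g \<Rightarrow> complex) \<Rightarrow> 'g \<Rightarrow> complex" where
  "gconv br f g x = (LINT y|lborel. f y * g (gmult br (- y) x))"

section \<open>Function spaces\<close>

fun iterated_partial :: "'a::euclidean_space list \<Rightarrow> ('a \<Rightarrow> complex) \<Rightarrow> 'a \<Rightarrow> complex" where
  "iterated_partial [] f = f"
| "iterated_partial (b # bs) f = (\<lambda>x. frechet_derivative (iterated_partial bs f) (at x) b)"

definition schwartz :: "('a::euclidean_space \<Rightarrow> complex) \<Rightarrow> bool" where
  "schwartz f \<longleftrightarrow> (\<forall>bs. set bs \<subseteq> Basis \<longrightarrow>
     (\<forall>x. iterated_partial bs f differentiable (at x)) \<and>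
     (\<forall>N::nat. \<exists>B. \<forall>x. (1 + norm x) ^ N * norm (iterated_partial bs f x) \<le> B))"

definition Lp_norm :: "'a measure \<Rightarrow> ennreal \<Rightarrow> ('a \<Rightarrow> complex) \<Rightarrow> ennreal" where
  "Lp_norm M p f =
     (if f \<notin> borel_measurable M then \<infinity>
      else if p = \<infinity> then esssup M (\<lambda>x. ennreal (norm (f x)))
      else let r = enn2real p; I = (\<integral>\<^sup>+ x. ennreal (norm (f x) powr r) \<partial>M)
           in if I = \<infinity> then \<infinity> else ennreal (enn2real I powr (1 / r)))"

text \<open>Surface measure of the unit sphere: \<open>E\<close> has measure \<open>dim\<close> times the volume of the
  cone \<open>{r x | 0 < r < 1, x \<in> E}\<close>. It is a measure on the whole space, concentrated on the
  sphere.\<close>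

definition sphere_measure :: "'a::euclidean_space measure" where
  "sphere_measure = distr (density lborel (\<lambda>x. of_nat DIM('a) * indicator (ball 0 1) x)) borel sgn"

section \<open>The restriction operator of the full Laplacian\<close>

definition laguerre :: "real \<Rightarrow> nat \<Rightarrow> real \<Rightarrow> real" where
  "laguerre \<alpha> k x = (\<Sum>j\<le>k. (- 1) ^ j * ((real k + \<alpha>) gchoose (k - j)) * x ^ j / fact j)"

definition phi :: "nat \<Rightarrow> nat \<Rightarrow> real \<Rightarrow> 'v::euclidean_space \<Rightarrow> real" where
  "phi n k l z = laguerre (real n - 1) k (l * (norm z)\<^sup>2 / 2) * exp (- (l * (norm z)\<^sup>2 / 4))"

definition efun :: "nat \<Rightarrow> nat \<Rightarrow> 'c::euclidean_space \<Rightarrow> 'v::euclidean_space \<times> 'c \<Rightarrow> complex" where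
  "efun n k a = (\<lambda>(z, t). exp (- \<i> * of_real (a \<bullet> t)) * of_real (phi n k (norm a) z))"

definition lam :: "nat \<Rightarrow> nat \<Rightarrow> real \<Rightarrow> real" where
  "lam n k \<mu> = sqrt (4 * \<mu> + (2 * real k + real n)\<^sup>2) / 2 - (2 * real k + real n) / 2"

definition restriction_op ::
  "('v::euclidean_space \<times> 'c::euclidean_space \<Rightarrow> 'v \<times> 'c \<Rightarrow> 'v \<times> 'c) \<Rightarrow> nat \<Rightarrow> real
     \<Rightarrow> ('v \<times> 'c \<Rightarrow> complex) \<Rightarrow> 'v \<times> 'c \<Rightarrow> complex" where
  "restriction_op br n \<mu> f x =
     1 / (2 * of_real pi) ^ (n + DIM('c)) *
     (\<Sum>k. of_real (lam n k \<mu> ^ (n + DIM('c) - 1) * deriv (lam n k) \<mu>) *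
          (LINT a|sphere_measure. gconv br f (efun n k (lam n k \<mu> *\<^sub>R a)) x))"

end

theory Submission
  imports Defs
begin

text \<open>This is a Knapp example in the centre. Take \<open>\<mu> = n + 1\<close>, so that \<open>\<lambda>\<^sub>0(\<mu>) = 1\<close>, and test the
  inequality on \<open>f(z, t) = exp(- B |z|\<^sup>2) w(t)\<close>, where \<open>w\<close> is a modulated Gaussian whose Fourier
  transform is concentrated on the cap of radius \<open>\<delta>\<close> of the unit sphere around a basis vector \<open>e\<close>.
  Since \<open>\<lambda>\<^sub>k(\<mu>)\<close> stays away from 1 for \<open>k \<ge> 1\<close>, the terms with \<open>k \<ge> 1\<close> contribute only
  \<open>O(exp(- c / \<delta>\<^sup>4))\<close> relative to the Fourier mass. The term \<open>k = 0\<close> has modulus at least a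
  multiple of \<open>\<delta> powr (- 2)\<close> for \<open>z\<close> near 0 and \<open>t\<close> in the box dual to the cap, whose volume is of order
  \<open>\<delta> powr (- (m + 1))\<close>, whereas the \<open>L\<^sup>p\<close> norm of \<open>f\<close> is of order \<open>\<delta> powr (- (m + 1) / p)\<close>. Letting
  \<open>\<delta>\<close> tend to 0 gives \<open>2 + (m + 1) / p' \<le> (m + 1) / p\<close>.\<close>

section \<open>Schwartz functions of Gaussian type\<close>

text \<open>The power of \<delta> in the leading term is a balance: the Fourier transform of
  \<open>wave\<close> has height of order 1/\<delta>^(m+1), the cap has surface measure of order
  \<delta>^(m-1), and their product is 1/\<delta>^2. Because the bracket depends on the z-components
  alone and takes values in the centre, its phase splits off: at fixed (z, t) the convolution is a
  product of a Fourier transform in s and a twisted Gaussian integral in w. At z = 0 the latter is a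
  positive constant when k = 0, so it neither cancels nor depends on the direction of a. Gaussians
  make every integral in t explicit, but their transforms vanish nowhere, so all spheres of radius
  \<lambda>_k contribute. For k \<ge> 1 that radius is at most (n+1)/(n+2); hence the sphere stays
  at normal distance at least 1/(n+2) from e, and in the normal unit \<delta>^2 of the cap this
  distance blows up. Summing over k needs bounds on the Laguerre functions uniform in k; these grow
  in z like exp(\<mu>|z|^2 / 2), which is why the z-Gaussian must have rate \<open>B\<close> above
  \<mu>.\<close>

inductive poly_fun :: "('a::euclidean_space \<Rightarrow> complex) \<Rightarrow> bool" where
  const: "poly_fun (\<lambda>x. c)"
| coord: "poly_fun (\<lambda>x. of_real (x \<bullet> b))"
| add: "poly_fun f \<Longrightarrow> poly_fun g \<Longrightarrow> poly_fun (\<lambda>x. f x + g x)"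
| mult: "poly_fun f \<Longrightarrow> poly_fun g \<Longrightarrow> poly_fun (\<lambda>x. f x * g x)"

lemma poly_fun_sum:
  "finite A \<Longrightarrow> (\<And>i. i \<in> A \<Longrightarrow> poly_fun (f i)) \<Longrightarrow> poly_fun (\<lambda>x. \<Sum>i\<in>A. f i x)"
  by (induction A rule: finite_induct) (auto intro: poly_fun.intros)

text \<open>The polynomial dependence is asserted for a fixed direction h and varying base point x:
  an iterated partial derivative freezes the direction and is then differentiated again in
  x.\<close>

lemma poly_fun_derivative:
  "poly_fun f \<Longrightarrow>
    \<exists>D. (\<forall>x. (f has_derivative D x) (at x)) \<and> (\<forall>h. poly_fun (\<lambda>x. D x h))"
proof (induction rule: poly_fun.induct)
  case (const c)
  show ?case by (rule exI[of _ "\<lambda>x h. 0"]) (auto intro: poly_fun.intros)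
next
  case (coord b)
  show ?case
    by (rule exI[of _ "\<lambda>x h. of_real (h \<bullet> b)"])
      (auto intro!: poly_fun.intros derivative_eq_intros)
next
  case (add f g)
  then obtain D E where
    "\<forall>x. (f has_derivative D x) (at x)" "\<forall>h. poly_fun (\<lambda>x. D x h)"
    "\<forall>x. (g has_derivative E x) (at x)" "\<forall>h. poly_fun (\<lambda>x. E x h)" by blast
  then show ?case
    by (intro exI[of _ "\<lambda>x h. D x h + E x h"])
      (auto intro!: poly_fun.add derivative_intros)
next
  case (mult f g)
  then obtain D E where
    "\<forall>x. (f has_derivative D x) (at x)" "\<forall>h. poly_fun (\<lambda>x. D x h)"
    "\<forall>x. (g has_derivative E x) (at x)" "\<forall>h. poly_fun (\<lambda>x. E x h)" by blast
  with mult.hyps show ?case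
    by (intro exI[of _ "\<lambda>x h. f x * E x h + D x h * g x"])
      (auto intro!: poly_fun.add poly_fun.mult derivative_intros)
qed

lemma poly_fun_bound: "poly_fun f \<Longrightarrow> \<exists>C N. \<forall>x. norm (f x) \<le> C * (1 + norm x) ^ N"
proof (induction rule: poly_fun.induct)
  case (const c)
  show ?case by (rule exI[of _ "norm c"], rule exI[of _ 0]) auto
next
  case (coord b)
  have "\<bar>x \<bullet> b\<bar> \<le> norm b * (1 + norm x)" for x
    using Cauchy_Schwarz_ineq2[of x b] norm_ge_zero[of b] by (simp add: algebra_simps add_increasing)
  then show ?case by (intro exI[of _ "norm b"] exI[of _ 1]) auto
next
  case (add f g)
  then obtain C N D M where *: "\<And>x. norm (f x) \<le> C * (1 + norm x) ^ N"
    "\<And>x. norm (g x) \<le> D * (1 + norm x) ^ M" by blast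
  have "norm (f x + g x) \<le> (\<bar>C\<bar> + \<bar>D\<bar>) * (1 + norm x) ^ (N + M)" for x
  proof -
    have 1: "norm (f x) \<le> \<bar>C\<bar> * (1 + norm x) ^ (N + M)"
      by (rule order_trans[OF *(1)], rule mult_mono) (auto intro!: power_increasing)
    have 2: "norm (g x) \<le> \<bar>D\<bar> * (1 + norm x) ^ (N + M)"
      by (rule order_trans[OF *(2)], rule mult_mono) (auto intro!: power_increasing)
    show ?thesis using norm_triangle_ineq[of "f x" "g x"] 1 2 by (simp add: algebra_simps)
  qed
  then show ?case by blast
next
  case (mult f g)
  then obtain C N D M where *: "\<And>x. norm (f x) \<le> C * (1 + norm x) ^ N"
    "\<And>x. norm (g x) \<le> D * (1 + norm x) ^ M" by blast
  have "norm (f x * g x) \<le> (C * D) * (1 + norm x) ^ (N + M)" for x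
    using mult_mono'[OF *(1)[of x] *(2)[of x]] by (simp add: norm_mult power_add mult_ac)
  then show ?case by blast
qed

lemma has_derivative_exp_complex:
  fixes Q :: "'a::real_normed_vector \<Rightarrow> complex"
  assumes "(Q has_derivative E) (at x)"
  shows "((\<lambda>x. exp (Q x)) has_derivative (\<lambda>h. exp (Q x) * E h)) (at x)"
  using has_derivative_compose[OF assms DERIV_exp[unfolded has_field_derivative_def]] .

text \<open>Each partial derivative only changes the polynomial prefactor, replacing P by P times
  the derivative of Q plus the derivative of P.\<close>

lemma iterated_partial_exp_poly:
  assumes "poly_fun Q"
  shows "\<exists>P. poly_fun P \<and> iterated_partial bs (\<lambda>x. exp (Q x)) = (\<lambda>x. P x * exp (Q x))"
proof (induction bs)
  case Nil
  show ?case by (rule exI[of _ "\<lambda>x. 1"]) (auto intro: poly_fun.const)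
next
  case (Cons b bs)
  then obtain P where P: "poly_fun P"
    "iterated_partial bs (\<lambda>x. exp (Q x)) = (\<lambda>x. P x * exp (Q x))" by blast
  obtain D E where D: "\<And>x. (P has_derivative D x) (at x)" "\<And>h. poly_fun (\<lambda>x. D x h)"
    and E: "\<And>x. (Q has_derivative E x) (at x)" "\<And>h. poly_fun (\<lambda>x. E x h)"
    using poly_fun_derivative[OF P(1)] poly_fun_derivative[OF assms] by blast
  have "((\<lambda>x. P x * exp (Q x)) has_derivative
      (\<lambda>h. P x * (exp (Q x) * E x h) + D x h * exp (Q x))) (at x)" for x
    by (intro has_derivative_mult D(1) has_derivative_exp_complex E(1))
  from frechet_derivative_at[OF this, symmetric]
  have "iterated_partial (b # bs) (\<lambda>x. exp (Q x)) = (\<lambda>x. (P x * E x b + D x b) * exp (Q x))"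
    by (simp add: P(2) algebra_simps)
  moreover have "poly_fun (\<lambda>x. P x * E x b + D x b)"
    by (intro poly_fun.add poly_fun.mult P D E)
  ultimately show ?case by blast
qed

text \<open>One term of a nonnegative series is at most its sum. This serves the Schwartz decay
  below, and later it trades the exponentially small tail in 1/\<delta>^4 for a power of
  \<delta>.\<close>

lemma power_le_fact_exp: "x \<ge> 0 \<Longrightarrow> x ^ N \<le> fact N * exp x" for x :: real
proof -
  assume x: "x \<ge> 0"
  have "(\<Sum>n\<in>{N}. x ^ n /\<^sub>R fact n) \<le> (\<Sum>n. x ^ n /\<^sub>R fact n)"
    using x by (intro sum_le_suminf summable_exp_generic) auto
  then show ?thesis by (simp add: exp_def field_simps)
qed

lemma power_exp_bound:
  fixes c :: real
  assumes "c > 0"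
  shows "\<exists>B. \<forall>r\<ge>0. (1 + r) ^ N * exp (- c * r\<^sup>2) \<le> B"
proof (intro exI allI impI)
  fix r :: real assume r: "r \<ge> 0"
  have "(1 + r) ^ N * exp (- c * r\<^sup>2) \<le> fact N * exp (1 + r) * exp (- c * r\<^sup>2)"
    using power_le_fact_exp[of "1 + r" N] r by (intro mult_right_mono) auto
  also have "\<dots> = fact N * exp (1 + r - c * r\<^sup>2)"
    by (simp add: exp_add exp_diff exp_minus field_simps)
  also have "\<dots> \<le> fact N * exp (1 + 1 / (4 * c))"
  proof -
    have "0 \<le> (2 * c * r - 1)\<^sup>2 / (4 * c)" using assms by simp
    also have "\<dots> = c * r\<^sup>2 - r + 1 / (4 * c)"
      using assms by (simp add: field_simps power2_eq_square)
    finally show ?thesis by simp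
  qed
  finally show "(1 + r) ^ N * exp (- c * r\<^sup>2) \<le> fact N * exp (1 + 1 / (4 * c))" .
qed

lemma schwartz_exp_poly:
  assumes Q: "poly_fun Q" and "c > 0" and decay: "\<And>x. Re (Q x) \<le> - c * (norm x)\<^sup>2"
  shows "schwartz (\<lambda>x. exp (Q x))"
  unfolding schwartz_def
proof (intro allI impI conjI)
  fix bs :: "'a list" and x :: 'a
  obtain P where P: "poly_fun P"
    "iterated_partial bs (\<lambda>x. exp (Q x)) = (\<lambda>x. P x * exp (Q x))"
    using iterated_partial_exp_poly[OF Q] by blast
  obtain D E where D: "\<And>x. (P has_derivative D x) (at x)"
    and E: "\<And>x. (Q has_derivative E x) (at x)"
    using poly_fun_derivative[OF P(1)] poly_fun_derivative[OF Q] by blast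
  show "iterated_partial bs (\<lambda>x. exp (Q x)) differentiable at x"
    unfolding P(2)
    unfolding differentiable_def
    by (rule exI, rule has_derivative_mult[OF D has_derivative_exp_complex[OF E]])
  fix N :: nat
  obtain C M where C: "\<And>x. norm (P x) \<le> C * (1 + norm x) ^ M" using poly_fun_bound[OF P(1)] by blast
  have C0: "C \<ge> 0" using C[of 0] by (auto intro: order_trans[OF norm_ge_zero])
  obtain B where B: "\<And>r. r \<ge> 0 \<Longrightarrow> (1 + r) ^ (N + M) * exp (- c * r\<^sup>2) \<le> B"
    using power_exp_bound[OF \<open>c > 0\<close>] by blast
  show "\<exists>B. \<forall>x. (1 + norm x) ^ N * norm (iterated_partial bs (\<lambda>x. exp (Q x)) x) \<le> B"
  proof (intro exI allI)
    fix x
    have "(1 + norm x) ^ N * norm (P x * exp (Q x))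
        \<le> (1 + norm x) ^ N * ((C * (1 + norm x) ^ M) * exp (- c * (norm x)\<^sup>2))"
      unfolding norm_mult norm_exp_eq_Re using decay[of x] C[of x] C0
      by (intro mult_left_mono mult_mono) auto
    also have "\<dots> = C * ((1 + norm x) ^ (N + M) * exp (- c * (norm x)\<^sup>2))"
      by (simp add: power_add mult_ac)
    also have "\<dots> \<le> C * B" using B[of "norm x"] C0 by (intro mult_left_mono) auto
    finally show "(1 + norm x) ^ N * norm (iterated_partial bs (\<lambda>x. exp (Q x)) x) \<le> C * B"
      by (simp add: P(2))
  qed
qed

section \<open>Integrals of product functions\<close>

text \<open>Lebesgue measure is the image of the product measure over the coordinates, so Fubini
  reduces every Gaussian and every box integral below to dimension one. The predicate delivers
  integrability and value together.\<close>

lemma has_bochner_integral_prod_Basis: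
  fixes f :: "'a::euclidean_space \<Rightarrow> real \<Rightarrow> 'b::{real_normed_field,banach,second_countable_topology}"
  assumes f: "\<And>b. b \<in> Basis \<Longrightarrow> integrable lborel (f b)"
  shows "has_bochner_integral lborel (\<lambda>x::'a. \<Prod>b\<in>Basis. f b (x \<bullet> b))
           (\<Prod>b\<in>Basis. LINT s|lborel. f b s)"
proof -
  interpret product_sigma_finite "\<lambda>b::'a. lborel :: real measure" ..
  have meas: "(\<lambda>g. \<Sum>b\<in>Basis. g b *\<^sub>R b) \<in> measurable (\<Pi>\<^sub>M b\<in>Basis. lborel) (borel :: 'a measure)"
    by measurable
  have fm: "f b \<in> borel_measurable borel" if "b \<in> Basis" for b
    using f[OF that] by (auto dest: borel_measurable_integrable)
  have m: "(\<lambda>x::'a. \<Prod>b\<in>Basis. f b (x \<bullet> b)) \<in> borel_measurable borel"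
    using fm by (intro borel_measurable_prod) (auto intro: measurable_compose[rotated])
  have eq: "(\<Prod>b\<in>Basis. f b ((\<Sum>c\<in>Basis. g c *\<^sub>R c) \<bullet> b)) = (\<Prod>b\<in>Basis. f b (g b))" for g
    by (intro prod.cong refl) simp
  have "integrable (\<Pi>\<^sub>M b\<in>Basis. lborel) (\<lambda>g. \<Prod>b\<in>(Basis::'a set). f b (g b))"
    using f by (intro product_integrable_prod) auto
  moreover have "(\<integral>g. (\<Prod>b\<in>(Basis::'a set). f b (g b)) \<partial>(\<Pi>\<^sub>M b\<in>Basis. lborel)) =
      (\<Prod>b\<in>Basis. LINT s|lborel. f b s)"
    using f by (intro product_integral_prod) auto
  ultimately show ?thesis
    by (subst lborel_eq)
      (simp add: has_bochner_integral_iff integrable_distr_eq[OF meas m] integral_distr[OF meas m] eq)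
qed

lemma has_bochner_integral_pair_mult:
  fixes f :: "'a::euclidean_space \<Rightarrow> 'c::{real_normed_field,banach,second_countable_topology}"
    and g :: "'b::euclidean_space \<Rightarrow> 'c"
  assumes f: "integrable lborel f" and g: "integrable lborel g"
  shows "has_bochner_integral lborel (\<lambda>(x, y). f x * g y) ((LINT x|lborel. f x) * (LINT y|lborel. g y))"
proof -
  have [measurable]: "f \<in> borel_measurable borel" "g \<in> borel_measurable borel"
    using f g by (auto dest: borel_measurable_integrable)
  have i: "integrable (lborel \<Otimes>\<^sub>M lborel) (\<lambda>(x, y). f x * g y)"
  proof (rule lborel_pair.Fubini_integrable)
    show "(\<lambda>(x, y). f x * g y) \<in> borel_measurable (lborel \<Otimes>\<^sub>M lborel)" by measurable
    show "integrable lborel (\<lambda>x. \<integral>y. norm (case (x, y) of (x, y) \<Rightarrow> f x * g y) \<partial>lborel)"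
      using f g by (simp add: norm_mult)
    show "AE x in lborel. integrable lborel (\<lambda>y. case (x, y) of (x, y) \<Rightarrow> f x * g y)"
      using g by simp
  qed
  have "(\<integral>x. (\<integral>y. f x * g y \<partial>lborel) \<partial>lborel) = integral\<^sup>L (lborel \<Otimes>\<^sub>M lborel) (\<lambda>(x, y). f x * g y)"
    by (rule lborel_pair.integral_fst'[OF i, unfolded split_conv])
  with i show ?thesis by (simp add: has_bochner_integral_iff lborel_prod)
qed

section \<open>Gaussian integrals\<close>

text \<open>This is the characteristic function of the standard normal distribution at frequency
  \<theta> / d, followed by the substitution of d * s for s.\<close>

lemma gaussian_fourier_1d:
  fixes d \<theta> :: real
  assumes d: "d > 0"
  shows "has_bochner_integral lborel (\<lambda>s. exp (\<i> * of_real (\<theta> * s) - of_real (d\<^sup>2 * s\<^sup>2 / 2)))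
           (of_real (sqrt (2 * pi) / d * exp (- (\<theta>\<^sup>2 / (2 * d\<^sup>2)))) :: complex)"
proof -
  let ?h = "\<lambda>s. exp (\<i> * of_real (\<theta> / d * s) - of_real (s\<^sup>2 / 2)) :: complex"
  have std: "std_normal_density s *\<^sub>R iexp (\<theta> / d * s) = ?h s / of_real (sqrt (2 * pi))" for s
  proof -
    have "?h s = iexp (\<theta> / d * s) * of_real (exp (- (s\<^sup>2 / 2)))"
      unfolding exp_of_real[symmetric] by (simp flip: exp_add)
    then show ?thesis by (simp add: std_normal_density_def scaleR_conv_of_real)
  qed
  have "integrable std_normal_distribution (\<lambda>s. iexp (\<theta> / d * s))"
    using real_dist_normal_dist
    by (intro finite_measure.integrable_const_bound[of _ _ 1])
      (auto simp: real_distribution_def prob_space_def)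
  then have "integrable lborel (\<lambda>s. std_normal_density s *\<^sub>R iexp (\<theta> / d * s))"
    by (subst (asm) integrable_density) auto
  then have "integrable lborel (\<lambda>s. of_real (sqrt (2 * pi)) * (?h s / of_real (sqrt (2 * pi))))"
    unfolding std by (rule integrable_mult_right)
  then have i: "integrable lborel ?h" by simp
  have "char std_normal_distribution (\<theta> / d) = (\<integral>s. ?h s / of_real (sqrt (2 * pi)) \<partial>lborel)"
    unfolding char_def std[symmetric] by (rule integral_density) auto
  then have I: "(\<integral>s. ?h s \<partial>lborel) = of_real (sqrt (2 * pi) * exp (- (\<theta> / d)\<^sup>2 / 2))"
    by (simp add: char_std_normal_distribution field_simps flip: of_real_exp)
  have h: "has_bochner_integral lborel ?h (of_real (sqrt (2 * pi) * exp (- (\<theta> / d)\<^sup>2 / 2)))"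
    using i I by (simp add: has_bochner_integral_iff)
  have "has_bochner_integral lborel (\<lambda>s. ?h (0 + d * s))
      (of_real (sqrt (2 * pi) * exp (- (\<theta> / d)\<^sup>2 / 2)) /\<^sub>R \<bar>d\<bar>)"
    using lborel_has_bochner_integral_real_affine_iff[of d ?h _ 0] d h by simp
  then show ?thesis using d
    by (simp add: scaleR_conv_of_real power_mult_distrib power_divide field_simps)
qed

lemma gaussian_1d:
  fixes d :: real
  assumes d: "d > 0"
  shows "has_bochner_integral lborel (\<lambda>s::real. exp (- (d\<^sup>2 * s\<^sup>2 / 2))) (sqrt (2 * pi) / d)"
proof -
  have "has_bochner_integral lborel (\<lambda>s. Re (exp (\<i> * of_real (0 * s) - of_real (d\<^sup>2 * s\<^sup>2 / 2))))
     (Re (of_real (sqrt (2 * pi) / d * exp (- (0\<^sup>2 / (2 * d\<^sup>2))))))"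
    by (rule has_bochner_integral_Re[OF gaussian_fourier_1d[OF d]])
  then show ?thesis by (simp add: Re_exp)
qed

lemma norm_sq_Basis: "(norm (x::'a::euclidean_space))\<^sup>2 = (\<Sum>b\<in>Basis. (x \<bullet> b)\<^sup>2)"
  using euclidean_inner[of x x] by (simp add: power2_norm_eq_inner power2_eq_square[of "_ \<bullet> _"])

lemma gaussian_integral:
  fixes c :: real
  assumes c: "c > 0"
  shows "has_bochner_integral lborel (\<lambda>x::'a::euclidean_space. exp (- (c * (norm x)\<^sup>2)))
           ((sqrt (2 * pi) / sqrt (2 * c)) ^ DIM('a))"
proof -
  have g: "has_bochner_integral lborel (\<lambda>s::real. exp (- (c * s\<^sup>2))) (sqrt (2 * pi) / sqrt (2 * c))"
    using gaussian_1d[of "sqrt (2 * c)"] c by simp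
  have "has_bochner_integral lborel (\<lambda>x::'a. \<Prod>b\<in>Basis. exp (- (c * (x \<bullet> b)\<^sup>2)))
      (\<Prod>b\<in>(Basis::'a set). LINT s|lborel. exp (- (c * s\<^sup>2)))"
    by (rule has_bochner_integral_prod_Basis) (use g in \<open>auto simp: has_bochner_integral_iff\<close>)
  then show ?thesis using g
    by (simp add: has_bochner_integral_iff norm_sq_Basis sum_distrib_left sum_negf flip: exp_sum)
qed

section \<open>Anisotropic Gaussians adapted to a spherical cap\<close>

text \<open>The cap of radius \<open>\<delta>\<close> around the pole \<open>e\<close> has size \<open>\<delta>\<close> in the tangential directions
  and \<open>\<delta>\<^sup>2\<close> in the normal direction.\<close>

definition dil :: "'c::euclidean_space \<Rightarrow> real \<Rightarrow> 'c \<Rightarrow> real" where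
  "dil e \<delta> b = (if b = e then \<delta>\<^sup>2 else \<delta>)"

definition cap_gauss :: "'c::euclidean_space \<Rightarrow> real \<Rightarrow> 'c \<Rightarrow> real" where
  "cap_gauss e \<delta> a = exp (- ((\<Sum>b\<in>Basis. ((a - e) \<bullet> b / dil e \<delta> b)\<^sup>2) / 2))"

text \<open>A majorant for error terms. The exponent is half of that of \<open>cap_gauss\<close>,
  which leaves room to absorb a linear factor, and the normal direction is dropped because on the
  sphere the tangential coordinates alone confine a point to the caps around e and its
  antipode.\<close>

definition tang_gauss :: "'c::euclidean_space \<Rightarrow> real \<Rightarrow> 'c \<Rightarrow> real" where
  "tang_gauss e \<delta> a = exp (- ((\<Sum>b\<in>Basis - {e}. (a \<bullet> b / \<delta>)\<^sup>2) / 4))"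

text \<open>The inverse Fourier transform of \<open>cap_gauss\<close> up to a constant. The sign of
  the modulation fits the kernel exp(\<i> a \<bullet> s), which is what convolution with exp(- \<i>
  a \<bullet> t) produces, so the peak sits at e.\<close>

definition wave :: "'c::euclidean_space \<Rightarrow> real \<Rightarrow> 'c \<Rightarrow> complex" where
  "wave e \<delta> t = exp (- \<i> * of_real (e \<bullet> t) - of_real ((\<Sum>b\<in>Basis. (dil e \<delta> b * (t \<bullet> b))\<^sup>2) / 2))"

lemma dil_pos: "\<delta> > 0 \<Longrightarrow> dil e \<delta> b > 0"
  by (simp add: dil_def)

text \<open>The source of the exponent m + 1: there are m - 1 tangential factors \<delta> and one
  normal factor \<delta>^2.\<close>

lemma prod_dil: "e \<in> Basis \<Longrightarrow> (\<Prod>b\<in>Basis. dil e \<delta> b) = \<delta> ^ (DIM('c) + 1)"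
  for e :: "'c::euclidean_space"
proof -
  assume e: "e \<in> Basis"
  have "(\<Prod>b\<in>Basis. dil e \<delta> b) = dil e \<delta> e * (\<Prod>b\<in>Basis - {e}. dil e \<delta> b)"
    by (rule prod.remove) (use e in auto)
  also have "(\<Prod>b\<in>Basis - {e}. dil e \<delta> b) = \<delta> ^ (DIM('c) - 1)"
    using e by (simp add: dil_def)
  finally show ?thesis
    using DIM_positive[where 'a='c] by (cases "DIM('c)") (auto simp: dil_def power2_eq_square)
qed

lemma borel_measurable_gauss [measurable]:
  "cap_gauss e \<delta> \<in> borel_measurable borel" "tang_gauss e \<delta> \<in> borel_measurable borel"
  "wave e \<delta> \<in> borel_measurable borel"
  unfolding cap_gauss_def[abs_def] tang_gauss_def[abs_def] wave_def[abs_def] by measurable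

lemma gauss_bounds: "0 \<le> cap_gauss e \<delta> a" "cap_gauss e \<delta> a \<le> 1"
  "0 \<le> tang_gauss e \<delta> a" "tang_gauss e \<delta> a \<le> 1"
  by (auto simp: cap_gauss_def tang_gauss_def sum_nonneg)

lemma wave_fourier:
  fixes e :: "'c::euclidean_space"
  assumes e: "e \<in> Basis" and \<delta>: "\<delta> > 0"
  shows "has_bochner_integral lborel (\<lambda>t. wave e \<delta> t * exp (\<i> * of_real (a \<bullet> t)))
           (of_real (sqrt (2 * pi) ^ DIM('c) / \<delta> ^ (DIM('c) + 1) * cap_gauss e \<delta> a))"
proof -
  let ?g = "\<lambda>b s. exp (\<i> * of_real (((a - e) \<bullet> b) * s) - of_real ((dil e \<delta> b)\<^sup>2 * s\<^sup>2 / 2)) :: complex"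
  let ?v = "\<lambda>b. sqrt (2 * pi) / dil e \<delta> b * exp (- (((a - e) \<bullet> b)\<^sup>2 / (2 * (dil e \<delta> b)\<^sup>2)))"
  have g: "has_bochner_integral lborel (?g b) (of_real (?v b))" for b
    by (rule gaussian_fourier_1d[OF dil_pos[OF \<delta>]])
  have "has_bochner_integral lborel (\<lambda>t::'c. \<Prod>b\<in>Basis. ?g b (t \<bullet> b)) (\<Prod>b\<in>Basis. LINT s|lborel. ?g b s)"
    by (rule has_bochner_integral_prod_Basis) (use g in \<open>auto simp: has_bochner_integral_iff\<close>)
  moreover have "(\<Prod>b\<in>(Basis::'c set). LINT s|lborel. ?g b s) =
      of_real (sqrt (2 * pi) ^ DIM('c) / \<delta> ^ (DIM('c) + 1) * cap_gauss e \<delta> a)"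
  proof -
    have "(\<Prod>b\<in>(Basis::'c set). LINT s|lborel. ?g b s) = of_real (\<Prod>b\<in>(Basis::'c set). ?v b)"
      using g by (simp add: has_bochner_integral_iff del: of_real_mult of_real_divide)
    also have "(\<Prod>b\<in>(Basis::'c set). ?v b) = sqrt (2 * pi) ^ DIM('c) / \<delta> ^ (DIM('c) + 1) * cap_gauss e \<delta> a"
      by (simp add: prod.distrib prod_dividef prod_dil[OF e] cap_gauss_def power_divide sum_divide_distrib
          sum_negf mult.commute flip: exp_sum)
    finally show ?thesis .
  qed
  moreover have "(\<Prod>b\<in>Basis. ?g b (t \<bullet> b)) = wave e \<delta> t * exp (\<i> * of_real (a \<bullet> t))" for t :: 'c
  proof -
    have "(\<Prod>b\<in>Basis. ?g b (t \<bullet> b)) = exp (\<Sum>b\<in>Basis. \<i> * of_real (((a - e) \<bullet> b) * (t \<bullet> b))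
        - of_real ((dil e \<delta> b)\<^sup>2 * (t \<bullet> b)\<^sup>2 / 2))"
      by (simp add: exp_sum)
    also have "(\<Sum>b\<in>Basis. \<i> * of_real (((a - e) \<bullet> b) * (t \<bullet> b)) - of_real ((dil e \<delta> b)\<^sup>2 * (t \<bullet> b)\<^sup>2 / 2))
        = \<i> * of_real ((a - e) \<bullet> t) - of_real ((\<Sum>b\<in>Basis. (dil e \<delta> b * (t \<bullet> b))\<^sup>2) / 2)"
      unfolding euclidean_inner[of "a - e" t]
      by (simp add: sum_subtractf sum_distrib_left power_mult_distrib sum_divide_distrib)
    also have "exp \<dots> = wave e \<delta> t * exp (\<i> * of_real (a \<bullet> t))"
      by (simp add: wave_def inner_diff_left algebra_simps flip: exp_add)
    finally show ?thesis .
  qed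
  ultimately show ?thesis by simp
qed

lemma wave_powr_integral:
  fixes e :: "'c::euclidean_space"
  assumes e: "e \<in> Basis" and \<delta>: "\<delta> > 0" and p: "p > 0"
  shows "has_bochner_integral lborel (\<lambda>t. norm (wave e \<delta> t) powr p)
           ((sqrt (2 * pi) / sqrt p) ^ DIM('c) / \<delta> ^ (DIM('c) + 1))"
proof -
  let ?g = "\<lambda>b s. exp (- ((sqrt p * dil e \<delta> b)\<^sup>2 * s\<^sup>2 / 2))"
  have g: "has_bochner_integral lborel (?g b) (sqrt (2 * pi) / (sqrt p * dil e \<delta> b))" for b
    by (rule gaussian_1d) (use dil_pos[OF \<delta>, of e b] p in auto)
  have "has_bochner_integral lborel (\<lambda>t::'c. \<Prod>b\<in>Basis. ?g b (t \<bullet> b)) (\<Prod>b\<in>Basis. LINT s|lborel. ?g b s)"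
    by (rule has_bochner_integral_prod_Basis) (use g in \<open>auto simp: has_bochner_integral_iff\<close>)
  moreover have "(\<Prod>b\<in>(Basis::'c set). LINT s|lborel. ?g b s) =
      (sqrt (2 * pi) / sqrt p) ^ DIM('c) / \<delta> ^ (DIM('c) + 1)"
    using g by (simp add: has_bochner_integral_iff prod.distrib prod_dividef prod_dil[OF e] power_divide)
  moreover have "(\<Prod>b\<in>Basis. ?g b (t \<bullet> b)) = norm (wave e \<delta> t) powr p" for t :: 'c
  proof -
    have "(\<Prod>b\<in>Basis. ?g b (t \<bullet> b)) = exp (- (\<Sum>b\<in>Basis. (sqrt p * dil e \<delta> b)\<^sup>2 * (t \<bullet> b)\<^sup>2 / 2))"
      by (simp add: exp_sum sum_negf[symmetric] del: sum_negf)
    also have "\<dots> = norm (wave e \<delta> t) powr p"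
      using p by (simp add: wave_def powr_def power_mult_distrib sum_divide_distrib sum_distrib_left mult_ac)
    finally show ?thesis .
  qed
  ultimately show ?thesis by simp
qed

text \<open>With u the vector of rescaled coordinates of a - e and U its squared length,
  \<open>cap_gauss\<close> is exp(- U / 2). Half of this exponent absorbs each coordinate of u, the
  other half is still below \<open>tang_gauss\<close>. The weighted inequality controls the phase
  error on the box dual to the cap.\<close>

lemma cap_le_tang:
  fixes e :: "'c::euclidean_space"
  assumes e: "e \<in> Basis" and \<delta>: "\<delta> > 0"
  shows "cap_gauss e \<delta> a \<le> tang_gauss e \<delta> a"
    and "cap_gauss e \<delta> a * (\<Sum>b\<in>Basis. \<bar>(a - e) \<bullet> b\<bar> / dil e \<delta> b) \<le> DIM('c) * tang_gauss e \<delta> a"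
proof -
  define u where "u b = \<bar>(a - e) \<bullet> b\<bar> / dil e \<delta> b" for b
  define U where "U = (\<Sum>b\<in>Basis. (u b)\<^sup>2)"
  have U0: "U \<ge> 0" by (simp add: U_def sum_nonneg)
  have cap: "cap_gauss e \<delta> a = exp (- (U / 2))"
    by (simp add: cap_gauss_def U_def u_def power_divide)
  have tang: "tang_gauss e \<delta> a = exp (- ((\<Sum>b\<in>Basis - {e}. (u b)\<^sup>2) / 4))"
  proof -
    have "(\<Sum>b\<in>Basis - {e}. (a \<bullet> b / \<delta>)\<^sup>2) = (\<Sum>b\<in>Basis - {e}. (u b)\<^sup>2)"
      by (intro sum.cong refl) (use e in \<open>auto simp: u_def dil_def power_divide inner_diff_left inner_Basis\<close>)
    then show ?thesis by (simp add: tang_gauss_def)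
  qed
  have "(\<Sum>b\<in>Basis - {e}. (u b)\<^sup>2) \<le> U" unfolding U_def by (intro sum_mono2) auto
  then have T: "exp (- (U / 4)) \<le> tang_gauss e \<delta> a" by (simp add: tang)
  show "cap_gauss e \<delta> a \<le> tang_gauss e \<delta> a"
    by (rule order_trans[OF _ T]) (use U0 in \<open>simp add: cap\<close>)
  have "u b \<le> exp (U / 4)" if "b \<in> Basis" for b
  proof -
    \<comment> \<open>The square gives u \<le> 1 + u^2 / 4, which is the form to which 1 + y \<le>
      exp y applies.\<close>
    have "0 \<le> (u b / 2 - 1)\<^sup>2" by simp
    then have "u b \<le> 1 + (u b)\<^sup>2 / 4" by (simp add: power2_eq_square algebra_simps)
    also have "\<dots> \<le> exp ((u b)\<^sup>2 / 4)" by (rule exp_ge_add_one_self)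
    also have "(u b)\<^sup>2 \<le> U" unfolding U_def using that by (intro member_le_sum) auto
    finally show ?thesis by simp
  qed
  then have "(\<Sum>b\<in>Basis. u b) \<le> DIM('c) * exp (U / 4)"
    using sum_bounded_above[of "Basis::'c set" u "exp (U / 4)"] by simp
  then have "cap_gauss e \<delta> a * (\<Sum>b\<in>Basis. u b) \<le> exp (- (U / 2)) * (DIM('c) * exp (U / 4))"
    unfolding cap by (intro mult_left_mono) auto
  also have "\<dots> = DIM('c) * exp (- (U / 4))"
    by (simp add: field_simps flip: exp_add)
  also have "\<dots> \<le> DIM('c) * tang_gauss e \<delta> a" by (intro mult_left_mono T) auto
  finally show "cap_gauss e \<delta> a * (\<Sum>b\<in>Basis. \<bar>(a - e) \<bullet> b\<bar> / dil e \<delta> b) \<le> DIM('c) * tang_gauss e \<delta> a"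
    by (simp add: u_def)
qed

section \<open>Integration over the sphere\<close>

lemma sets_sphere_measure [measurable_cong, simp]: "sets sphere_measure = sets borel"
  by (simp add: sphere_measure_def)

lemma space_sphere_measure [simp]: "space sphere_measure = UNIV"
  by (simp add: sphere_measure_def)

lemma borel_measurable_sgn [measurable]: "sgn \<in> borel_measurable (borel :: 'a::euclidean_space measure)"
  unfolding sgn_div_norm[abs_def] by measurable

lemma sphere_measure_eq:
  "(sphere_measure :: 'a::euclidean_space measure) =
     distr (density lborel (\<lambda>x. ennreal (real DIM('a) * indicator (ball 0 1) x))) borel sgn"
  unfolding sphere_measure_def
  by (simp add: ennreal_mult ennreal_indicator ennreal_of_nat_eq_real_of_nat)

text \<open>The cone definition of surface measure turns a spherical integral into one over the unit
  ball of the radially constant extension. No parametrisation of the sphere is needed: both cap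
  estimates become comparisons with product functions in Cartesian coordinates.\<close>

lemma
  fixes g :: "'a::euclidean_space \<Rightarrow> 'b::{banach,second_countable_topology}"
  assumes [measurable]: "g \<in> borel_measurable borel"
  shows integrable_sphere: "integrable sphere_measure g \<longleftrightarrow>
            integrable lborel (\<lambda>x. (real DIM('a) * indicator (ball 0 1) x) *\<^sub>R g (sgn x))"
    and integral_sphere: "(LINT a|sphere_measure. g a) =
            (LINT x|lborel. (real DIM('a) * indicator (ball 0 1) x) *\<^sub>R g (sgn x))"
proof -
  have [measurable]: "(\<lambda>x. real DIM('a) * indicator (ball (0::'a) 1) x) \<in> borel_measurable borel"
    by (intro borel_measurable_times borel_measurable_const borel_measurable_indicator) auto
  show "integrable sphere_measure g \<longleftrightarrow>
            integrable lborel (\<lambda>x. (real DIM('a) * indicator (ball 0 1) x) *\<^sub>R g (sgn x))"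
    unfolding sphere_measure_eq
    by (subst integrable_distr_eq, measurable, subst integrable_density, auto)
  show "(LINT a|sphere_measure. g a) =
            (LINT x|lborel. (real DIM('a) * indicator (ball 0 1) x) *\<^sub>R g (sgn x))"
    unfolding sphere_measure_eq
    by (subst integral_distr, measurable, subst integral_density, auto)
qed

lemma borel_measurable_ball_density [measurable]:
  "(\<lambda>x. of_nat DIM('a) * indicator (ball (0::'a::euclidean_space) 1) x :: ennreal) \<in> borel_measurable borel"
  by (intro borel_measurable_times_ennreal borel_measurable_const borel_measurable_indicator) auto

lemma finite_measure_sphere: "finite_measure (sphere_measure :: 'a::euclidean_space measure)"
proof
  have "emeasure (sphere_measure :: 'a measure) UNIV = DIM('a) * emeasure lborel (ball (0::'a) 1)"
    unfolding sphere_measure_def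
    by (subst emeasure_distr, measurable, simp, subst emeasure_density)
      (use borel_measurable_ball_density[where 'a='a] in \<open>simp_all add: nn_integral_cmult_indicator\<close>)
  also have "\<dots> < \<infinity>"
    using emeasure_lborel_ball_finite[of "0::'a" 1]
    by (simp add: ennreal_mult_less_top ennreal_of_nat_eq_real_of_nat)
  finally show "emeasure (sphere_measure :: 'a measure) (space sphere_measure) \<noteq> \<infinity>" by simp
qed

lemma AE_sphere: "AE a in (sphere_measure :: 'a::euclidean_space measure). norm a = 1"
proof -
  have "AE x in lborel. x \<noteq> (0::'a)" by (rule AE_lborel_singleton)
  then have "AE x in density lborel (\<lambda>x. of_nat DIM('a) * indicator (ball (0::'a) 1) x). x \<noteq> 0"
    by (subst AE_density) (use borel_measurable_ball_density[where 'a='a] in auto)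
  then show ?thesis
    unfolding sphere_measure_def by (subst AE_distr_iff) (auto simp: norm_sgn)
qed

lemma integrable_sphere_bounded:
  fixes g :: "'a::euclidean_space \<Rightarrow> 'b::{banach,second_countable_topology}"
  assumes "g \<in> borel_measurable borel" "\<And>a. norm a = 1 \<Longrightarrow> norm (g a) \<le> B"
  shows "integrable sphere_measure g"
proof -
  interpret finite_measure "sphere_measure :: 'a measure" by (rule finite_measure_sphere)
  show ?thesis
    by (rule integrable_const_bound[of _ B]) (use AE_sphere assms in auto)
qed

text \<open>Integrability is not assumed: a nonintegrable function has integral 0 by convention, and
  then B \<ge> 0 suffices. Upper bounds for the terms with k \<ge> 1 can thus be obtained without
  proving measurability in a.\<close>

lemma norm_integral_sphere_le:
  fixes g :: "'a::euclidean_space \<Rightarrow> 'b::{banach,second_countable_topology}"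
  assumes "\<And>a. norm a = 1 \<Longrightarrow> norm (g a) \<le> B" "B \<ge> 0"
  shows "norm (LINT a|sphere_measure. g a) \<le> B * measure (sphere_measure :: 'a measure) UNIV"
proof (cases "integrable sphere_measure g")
  case True
  interpret finite_measure "sphere_measure :: 'a measure" by (rule finite_measure_sphere)
  have "norm (LINT a|sphere_measure. g a) \<le> (LINT a|sphere_measure. norm (g a))"
    by (rule integral_norm_bound)
  also have "\<dots> \<le> (LINT a|(sphere_measure :: 'a measure). B)"
    by (rule integral_mono_AE) (use AE_sphere True assms in auto)
  finally show ?thesis by (simp add: mult.commute)
qed (use assms in \<open>simp add: not_integrable_integral_eq\<close>)

text \<open>Inside the unit ball passing from x to \<open>sgn x\<close> only enlarges coordinates,
  so the Gaussian at \<open>sgn x\<close> is at most the Gaussian at x. The ball is then enlarged to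
  the slab where the e-coordinate lies in [-1, 1]: that direction gives 2, and each tangential
  direction a full Gaussian integral proportional to \<delta>.\<close>

lemma tang_gauss_integral_upper:
  fixes e :: "'c::euclidean_space"
  assumes e: "e \<in> Basis" and \<delta>: "\<delta> > 0"
  shows "(LINT a|sphere_measure. tang_gauss e \<delta> a)
     \<le> 2 * DIM('c) * (sqrt (2 * pi) * sqrt 2) ^ (DIM('c) - 1) * \<delta> ^ (DIM('c) - 1)"
proof -
  define G where "G b s = (if b = e then indicator {-1..1} s else exp (- ((1 / (sqrt 2 * \<delta>))\<^sup>2 * s\<^sup>2 / 2)))"
    for b and s :: real
  have G: "has_bochner_integral lborel (G b) (if b = e then 2 else sqrt (2 * pi) / (1 / (sqrt 2 * \<delta>)))" for b
  proof (cases "b = e")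
    case True
    have "has_bochner_integral lborel (indicator {-1..1::real} :: real \<Rightarrow> real) (measure lborel {-1..1::real})"
      by (rule has_bochner_integral_real_indicator) auto
    then show ?thesis using True by (simp add: G_def[abs_def])
  next
    case False
    then show ?thesis using gaussian_1d[of "1 / (sqrt 2 * \<delta>)"] \<delta> by (simp add: G_def[abs_def])
  qed
  have P: "has_bochner_integral lborel (\<lambda>x::'c. \<Prod>b\<in>Basis. G b (x \<bullet> b)) (\<Prod>b\<in>Basis. LINT s|lborel. G b s)"
    by (rule has_bochner_integral_prod_Basis) (use G in \<open>auto simp: has_bochner_integral_iff\<close>)
  have val: "(\<Prod>b\<in>Basis. LINT s|lborel. G b s) = 2 * (sqrt (2 * pi) * sqrt 2 * \<delta>) ^ (DIM('c) - 1)"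
  proof -
    have "(\<Prod>b\<in>Basis. LINT s|lborel. G b s) = (LINT s|lborel. G e s) * (\<Prod>b\<in>Basis - {e}. LINT s|lborel. G b s)"
      by (rule prod.remove) (use e in auto)
    also have "(\<Prod>b\<in>Basis - {e}. LINT s|lborel. G b s) = (\<Prod>b\<in>Basis - {e}. sqrt (2 * pi) * sqrt 2 * \<delta>)"
      by (intro prod.cong refl) (use G in \<open>auto simp: has_bochner_integral_iff\<close>)
    finally show ?thesis using G[of e] e by (simp add: has_bochner_integral_iff)
  qed
  have le: "(real DIM('c) * indicator (ball 0 1) x) *\<^sub>R tang_gauss e \<delta> (sgn x)
      \<le> DIM('c) * (\<Prod>b\<in>Basis. G b (x \<bullet> b))" for x :: 'c
  proof (cases "x \<in> ball 0 1")
    case True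
    have "\<bar>x \<bullet> e\<bar> \<le> 1" using Basis_le_norm[OF e, of x] True by simp
    then have Ge: "G e (x \<bullet> e) = 1" by (simp add: G_def abs_le_iff)
    have "(x \<bullet> b)\<^sup>2 \<le> (sgn x \<bullet> b)\<^sup>2" for b
    proof (cases "x = 0")
      case False
      have "(x \<bullet> b)\<^sup>2 * (norm x)\<^sup>2 \<le> (x \<bullet> b)\<^sup>2 * 1"
        using True by (intro mult_left_mono) (auto simp: power_le_one)
      then show ?thesis using False by (simp add: sgn_div_norm power_mult_distrib power_divide field_simps)
    qed simp
    then have "(x \<bullet> b)\<^sup>2 / \<delta>\<^sup>2 \<le> (sgn x \<bullet> b)\<^sup>2 / \<delta>\<^sup>2" for b
      by (intro divide_right_mono) auto
    then have "tang_gauss e \<delta> (sgn x) \<le> exp (- ((\<Sum>b\<in>Basis - {e}. (x \<bullet> b / \<delta>)\<^sup>2) / 4))"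
      by (auto simp: tang_gauss_def power_divide intro!: sum_mono)
    also have "\<dots> = (\<Prod>b\<in>Basis - {e}. exp (- ((x \<bullet> b / \<delta>)\<^sup>2 / 4)))"
      by (simp add: sum_divide_distrib sum_negf flip: exp_sum)
    also have "\<dots> = (\<Prod>b\<in>Basis - {e}. G b (x \<bullet> b))"
      by (intro prod.cong refl) (auto simp: G_def power_divide power_mult_distrib)
    also have "\<dots> = (\<Prod>b\<in>Basis. G b (x \<bullet> b))"
      using e Ge by (subst prod.remove[of Basis e]) auto
    finally show ?thesis using True by simp
  next
    case False
    have "0 \<le> (\<Prod>b\<in>Basis. G b (x \<bullet> b))" by (intro prod_nonneg) (auto simp: G_def)
    then show ?thesis using False by simp
  qed
  have int: "integrable sphere_measure (tang_gauss e \<delta>)"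
    by (rule integrable_sphere_bounded[of _ 1]) (auto simp: gauss_bounds)
  have "(LINT a|sphere_measure. tang_gauss e \<delta> a) \<le> (LINT x|lborel. DIM('c) * (\<Prod>b\<in>Basis. G b (x \<bullet> b)))"
    unfolding integral_sphere[OF borel_measurable_gauss(2)]
    by (rule integral_mono[OF _ _ le])
      (use int P in \<open>auto simp: integrable_sphere has_bochner_integral_iff\<close>)
  also have "\<dots> = 2 * DIM('c) * (sqrt (2 * pi) * sqrt 2) ^ (DIM('c) - 1) * \<delta> ^ (DIM('c) - 1)"
    using P val by (simp add: has_bochner_integral_iff power_mult_distrib)
  finally show ?thesis .
qed

text \<open>It suffices to integrate over a thin box inside the unit ball whose radial projection
  lies in the cap; there every rescaled coordinate of a - e is at most 1, so
  \<open>cap_gauss\<close> is at least exp(- m). In the constant, m comes from the cone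
  normalisation, 1/4 is the length of the box along e, and \<delta> / (2 m) is its width in each
  tangential direction.\<close>

lemma cap_gauss_integral_lower:
  fixes e :: "'c::euclidean_space"
  assumes e: "e \<in> Basis" and \<delta>: "0 < \<delta>" "\<delta> \<le> 1"
  shows "DIM('c) * exp (- real DIM('c)) / 4 * (1 / (2 * DIM('c))) ^ (DIM('c) - 1) * \<delta> ^ (DIM('c) - 1)
     \<le> (LINT a|sphere_measure. cap_gauss e \<delta> a)"
proof -
  define m where "m = real DIM('c)"
  have m: "m \<ge> 1" using DIM_positive[where 'a='c] by (simp add: m_def Suc_leI)
  \<comment> \<open>Normalising divides by a norm of at least 1/4, so the tangential coordinates
    become at most \<delta> / m; the factor 1 / m keeps both the l1 norm of x below 1 and the sum of
    the tangential squares below \<delta>^2.\<close>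
  define r where "r = \<delta> / (4 * m)"
  have r: "r > 0" "r * m = \<delta> / 4" "r \<le> \<delta> / 4" using m \<delta> by (auto simp: r_def field_simps)
  define I where "I b = (if b = e then {1/4..1/2} else {-r..r})" for b
  define G where "G b s = (indicator (I b) s :: real)" for b s
  have G: "has_bochner_integral lborel (G b) (if b = e then 1 / 4 else 2 * r)" for b
  proof -
    have "has_bochner_integral lborel (indicator (I b) :: real \<Rightarrow> real) (measure lborel (I b))"
      by (rule has_bochner_integral_real_indicator) (auto simp: I_def emeasure_lborel_Icc_eq)
    then show ?thesis using r(1) by (auto simp: G_def[abs_def] I_def)
  qed
  have P: "has_bochner_integral lborel (\<lambda>x::'c. \<Prod>b\<in>Basis. G b (x \<bullet> b)) (\<Prod>b\<in>Basis. LINT s|lborel. G b s)"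
    by (rule has_bochner_integral_prod_Basis) (use G in \<open>auto simp: has_bochner_integral_iff\<close>)
  have val: "(\<Prod>b\<in>Basis. LINT s|lborel. G b s) = 1 / 4 * (2 * r) ^ (DIM('c) - 1)"
  proof -
    have "(\<Prod>b\<in>Basis. LINT s|lborel. G b s) = (LINT s|lborel. G e s) * (\<Prod>b\<in>Basis - {e}. LINT s|lborel. G b s)"
      by (rule prod.remove) (use e in auto)
    also have "(\<Prod>b\<in>Basis - {e}. LINT s|lborel. G b s) = (\<Prod>b\<in>Basis - {e}. 2 * r)"
      by (intro prod.cong refl) (use G in \<open>auto simp: has_bochner_integral_iff\<close>)
    finally show ?thesis using G[of e] e by (simp add: has_bochner_integral_iff)
  qed
  have le: "m * exp (- m) * (\<Prod>b\<in>Basis. G b (x \<bullet> b))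
     \<le> (real DIM('c) * indicator (ball 0 1) x) *\<^sub>R cap_gauss e \<delta> (sgn x)" for x :: 'c
  proof (cases "\<forall>b\<in>Basis. x \<bullet> b \<in> I b")
    case False
    then obtain b where "b \<in> Basis" "G b (x \<bullet> b) = 0" by (auto simp: G_def)
    then have "(\<Prod>b\<in>Basis. G b (x \<bullet> b)) = 0" by (intro prod_zero) auto
    then show ?thesis using gauss_bounds(1)[of e \<delta> "sgn x"] by (simp del: prod_zero_iff)
  next
    case True
    have xe: "1 / 4 \<le> x \<bullet> e" "x \<bullet> e \<le> 1 / 2" using True e by (auto simp: I_def split: if_splits)
    have xb: "\<bar>x \<bullet> b\<bar> \<le> r" if "b \<in> Basis - {e}" for b
      using True that by (auto simp: I_def abs_le_iff split: if_splits)
    have nx: "1 / 4 \<le> norm x" using Basis_le_norm[OF e, of x] xe by simp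
    have "norm x \<le> (\<Sum>b\<in>Basis. \<bar>x \<bullet> b\<bar>)" by (rule norm_le_l1)
    also have "\<dots> = \<bar>x \<bullet> e\<bar> + (\<Sum>b\<in>Basis - {e}. \<bar>x \<bullet> b\<bar>)" by (rule sum.remove) (use e in auto)
    also have "(\<Sum>b\<in>Basis - {e}. \<bar>x \<bullet> b\<bar>) \<le> real (card (Basis - {e})) * r"
      by (rule sum_bounded_above) (use xb in auto)
    also have "real (card (Basis - {e})) * r \<le> m * r"
      using r(1) e by (intro mult_right_mono) (auto simp: m_def)
    finally have "norm x < 1" using xe r(2) \<delta> by (simp add: mult.commute)
    define a where "a = sgn x"
    have na: "norm a = 1" using nx by (auto simp: a_def norm_sgn)
    have ab: "\<bar>a \<bullet> b\<bar> \<le> \<delta> / m" if "b \<in> Basis - {e}" for b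
    proof -
      have "\<bar>a \<bullet> b\<bar> = \<bar>x \<bullet> b\<bar> / norm x"
        by (simp add: a_def sgn_div_norm abs_mult divide_inverse mult.commute)
      also have "\<dots> \<le> r / (1 / 4)" using xb[OF that] nx by (intro frac_le) auto
      finally show ?thesis by (simp add: r_def)
    qed
    have ae: "a \<bullet> e \<ge> 0" using xe nx by (simp add: a_def sgn_div_norm)
    have ae1: "a \<bullet> e \<le> 1" using Basis_le_norm[OF e, of a] na by simp
    have "1 = (\<Sum>b\<in>Basis. (a \<bullet> b)\<^sup>2)" using norm_sq_Basis[of a] na by simp
    also have "\<dots> = (a \<bullet> e)\<^sup>2 + (\<Sum>b\<in>Basis - {e}. (a \<bullet> b)\<^sup>2)" by (rule sum.remove) (use e in auto)
    also have "(\<Sum>b\<in>Basis - {e}. (a \<bullet> b)\<^sup>2) \<le> real (card (Basis - {e})) * (\<delta> / m)\<^sup>2"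
      by (rule sum_bounded_above) (metis ab abs_le_square_iff abs_of_nonneg order_trans abs_ge_zero)
    also have "real (card (Basis - {e})) * (\<delta> / m)\<^sup>2 \<le> m * (\<delta> / m)\<^sup>2"
      using e by (intro mult_right_mono) (auto simp: m_def)
    also have "m * (\<delta> / m)\<^sup>2 = \<delta>\<^sup>2 / m" using m by (simp add: power2_eq_square)
    also have "\<delta>\<^sup>2 / m \<le> \<delta>\<^sup>2 / 1" using m by (intro divide_left_mono) auto
    finally have "1 - (a \<bullet> e)\<^sup>2 \<le> \<delta>\<^sup>2" by simp
    \<comment> \<open>Curvature enters here: on the unit sphere a tangential displacement \<delta>
      costs only \<delta>^2 in the normal direction.\<close>
    moreover have "1 - a \<bullet> e \<le> 1 - (a \<bullet> e)\<^sup>2"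
      using ae ae1 by (simp add: power2_eq_square mult_left_le)
    ultimately have e1: "\<bar>(a - e) \<bullet> e\<bar> \<le> dil e \<delta> e"
      using ae1 e by (simp add: inner_diff_left dil_def)
    have b1: "\<bar>(a - e) \<bullet> b\<bar> \<le> dil e \<delta> b" if "b \<in> Basis" for b
    proof (cases "b = e")
      case False
      have "\<delta> / m \<le> \<delta>" using m \<delta> by (simp add: field_simps)
      then show ?thesis using ab[of b] that False e by (simp add: dil_def inner_diff_left inner_Basis)
    qed (use e1 in simp)
    have "((a - e) \<bullet> b / dil e \<delta> b)\<^sup>2 \<le> 1" if "b \<in> Basis" for b
      using b1[OF that] dil_pos[OF \<delta>(1), of e b] by (simp add: abs_square_le_1)
    then have "(\<Sum>b\<in>Basis. ((a - e) \<bullet> b / dil e \<delta> b)\<^sup>2) \<le> m"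
      unfolding m_def using sum_bounded_above[of Basis "\<lambda>b. ((a - e) \<bullet> b / dil e \<delta> b)\<^sup>2" 1] by simp
    then have "exp (- m) \<le> cap_gauss e \<delta> a" using m by (simp add: cap_gauss_def)
    moreover have "(\<Prod>b\<in>Basis. G b (x \<bullet> b)) = 1"
      using True by (intro prod.neutral) (auto simp: G_def)
    ultimately show ?thesis using \<open>norm x < 1\<close> m by (simp add: a_def m_def)
  qed
  have int: "integrable sphere_measure (cap_gauss e \<delta>)"
    by (rule integrable_sphere_bounded[of _ 1]) (auto simp: gauss_bounds)
  have "m * exp (- m) * (1 / 4 * (2 * r) ^ (DIM('c) - 1))
      = (LINT x|lborel. m * exp (- m) * (\<Prod>b\<in>Basis. G b (x \<bullet> b)))"
    using P val by (simp add: has_bochner_integral_iff)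
  also have "\<dots> \<le> (LINT a|sphere_measure. cap_gauss e \<delta> a)"
    unfolding integral_sphere[OF borel_measurable_gauss(1)]
    by (rule integral_mono[OF _ _ le])
      (use int P in \<open>auto simp: integrable_sphere has_bochner_integral_iff\<close>)
  finally show ?thesis
    by (simp add: r_def m_def power_divide power_mult_distrib mult_ac)
qed

section \<open>Laguerre functions on the spectrum\<close>

text \<open>The binomial coefficient is the product of (s + i) / i for i from 1 to r, and each
  factor is at most s + 1.\<close>

lemma binomial_le_power: "(s + r) choose r \<le> (s + 1) ^ r"
proof (induction r)
  case (Suc r)
  have "Suc r * ((s + Suc r) choose Suc r) = (s + Suc r) * ((s + r) choose r)"
    using Suc_times_binomial_eq[of "s + r" r] by (simp add: mult.commute)
  also have "\<dots> \<le> (Suc r * (s + 1)) * (s + 1) ^ r"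
    using Suc by (intro mult_mono) auto
  finally have "Suc r * ((s + Suc r) choose Suc r) \<le> Suc r * (s + 1) ^ Suc r"
    by (simp only: power_Suc mult.assoc)
  then show ?case by (simp only: Suc_mult_le_cancel1)
qed simp

text \<open>Each coefficient is at most (k+1)^(n-1+j). The part (k+1)^(n-1) is common to all terms,
  and the remaining (k+1)^j combines with x^j into the exponential series of (k+1) x.\<close>

lemma laguerre_bound:
  assumes n: "n \<ge> 1" and x: "x \<ge> 0"
  shows "\<bar>laguerre (real n - 1) k x\<bar> \<le> (real k + 1) ^ (n - 1) * exp ((real k + 1) * x)"
proof -
  have coeff: "(real k + (real n - 1)) gchoose (k - j) \<le> (real k + 1) ^ (n - 1 + j)"
    "0 \<le> (real k + (real n - 1)) gchoose (k - j)" if "j \<le> k" for j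
  proof -
    have N: "real k + (real n - 1) = real (k + n - 1)" using n by simp
    have gb: "(real k + (real n - 1)) gchoose (k - j) = real ((k + n - 1) choose (k - j))"
      unfolding N by (simp add: binomial_gbinomial)
    \<comment> \<open>Symmetry is used because the lower index n - 1 + j does not grow with k, so
      the power bound stays polynomial in k for fixed j.\<close>
    have "(k + n - 1) choose (k - j) = ((k - j) + (n - 1 + j)) choose (n - 1 + j)"
      using that n binomial_symmetric[of "k - j" "k + n - 1"] by (simp add: algebra_simps)
    also have "\<dots> \<le> (k - j + 1) ^ (n - 1 + j)" by (rule binomial_le_power)
    also have "\<dots> \<le> (k + 1) ^ (n - 1 + j)" by (intro power_mono) auto
    finally have "real ((k + n - 1) choose (k - j)) \<le> real ((k + 1) ^ (n - 1 + j))"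
      by (simp only: of_nat_le_iff)
    then show "(real k + (real n - 1)) gchoose (k - j) \<le> (real k + 1) ^ (n - 1 + j)"
      unfolding gb by (simp add: add.commute)
    show "0 \<le> (real k + (real n - 1)) gchoose (k - j)" unfolding gb by simp
  qed
  have "\<bar>laguerre (real n - 1) k x\<bar>
      \<le> (\<Sum>j\<le>k. \<bar>(- 1) ^ j * ((real k + (real n - 1)) gchoose (k - j)) * x ^ j / fact j\<bar>)"
    unfolding laguerre_def by (rule sum_abs)
  also have "\<dots> \<le> (\<Sum>j\<le>k. (real k + 1) ^ (n - 1) * (((real k + 1) * x) ^ j / fact j))"
  proof (rule sum_mono)
    fix j assume "j \<in> {..k}"
    then have j: "j \<le> k" by simp
    have "\<bar>(- 1) ^ j * ((real k + (real n - 1)) gchoose (k - j)) * x ^ j / fact j\<bar>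
        = ((real k + (real n - 1)) gchoose (k - j)) * (x ^ j / fact j)"
      using coeff(2)[OF j] x by (simp add: abs_mult power_abs)
    also have "\<dots> \<le> (real k + 1) ^ (n - 1 + j) * (x ^ j / fact j)"
      using coeff(1)[OF j] x by (intro mult_right_mono) auto
    finally show "\<bar>(- 1) ^ j * ((real k + (real n - 1)) gchoose (k - j)) * x ^ j / fact j\<bar>
        \<le> (real k + 1) ^ (n - 1) * (((real k + 1) * x) ^ j / fact j)"
      by (simp add: power_add power_mult_distrib)
  qed
  also have "\<dots> = (real k + 1) ^ (n - 1) * (\<Sum>j\<le>k. ((real k + 1) * x) ^ j /\<^sub>R fact j)"
    by (simp add: sum_distrib_left divide_inverse mult.commute)
  also have "\<dots> \<le> (real k + 1) ^ (n - 1) * exp ((real k + 1) * x)"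
    unfolding exp_def using x
    by (intro mult_left_mono sum_le_suminf summable_exp_generic) auto
  finally show ?thesis .
qed

lemma laguerre_0 [simp]: "laguerre \<alpha> 0 x = 1"
  by (simp add: laguerre_def)

lemma phi_0: "phi n 0 l z = exp (- (l * (norm z)\<^sup>2 / 4))"
  by (simp add: phi_def)

text \<open>With c = 2k + n and s the square root of 4\<mu> + c^2, \<lambda>_k is (s - c) / 2 and
  \<lambda>_k (s + c) / 2 = \<mu>, so s > c gives \<lambda>_k c \<le> \<mu>. The bound with 2k + n
  yields the spectral gap between k = 0 and k \<ge> 1; those with k + 1 are for summation.\<close>

lemma lam_props:
  assumes \<mu>: "\<mu> > 0" and n: "n \<ge> 1"
  shows "lam n k \<mu> > 0" "lam n k \<mu> \<le> \<mu> / (2 * real k + real n)"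
    "lam n k \<mu> \<le> \<mu> / (real k + 1)"
    "0 < deriv (lam n k) \<mu>" "deriv (lam n k) \<mu> \<le> 1 / (real k + 1)"
proof -
  define c where "c = 2 * real k + real n"
  define s where "s = sqrt (4 * \<mu> + c\<^sup>2)"
  have c: "c > 0" "real k + 1 \<le> c" using n by (auto simp: c_def)
  have s2: "s\<^sup>2 = 4 * \<mu> + c\<^sup>2" using \<mu> by (simp add: s_def add_nonneg_nonneg)
  have sc: "s > c" unfolding s_def using c \<mu> by (intro real_less_rsqrt) auto
  have l: "lam n k \<mu> = (s - c) / 2" by (simp add: lam_def s_def c_def diff_divide_distrib)
  show pos: "lam n k \<mu> > 0" using sc by (simp add: l)
  have "lam n k \<mu> * c \<le> lam n k \<mu> * ((s + c) / 2)" using pos sc by (intro mult_left_mono) auto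
  also have "\<dots> = \<mu>" using s2 by (simp add: l power2_eq_square algebra_simps)
  finally have b: "lam n k \<mu> \<le> \<mu> / c" using c by (simp add: field_simps)
  then show "lam n k \<mu> \<le> \<mu> / (2 * real k + real n)" by (simp add: c_def)
  have "\<mu> / c \<le> \<mu> / (real k + 1)" using c \<mu> by (intro divide_left_mono) auto
  with b show "lam n k \<mu> \<le> \<mu> / (real k + 1)" by simp
  have "(lam n k has_real_derivative 1 / s) (at \<mu>)"
  proof -
    have "((\<lambda>\<mu>. sqrt (4 * \<mu> + c\<^sup>2) / 2 - c / 2) has_real_derivative 1 / s) (at \<mu>)"
    proof -
      have "4 * \<mu> + c\<^sup>2 > 0" using \<mu> by (simp add: add_pos_nonneg)
      moreover have "((\<lambda>\<mu>. 4 * \<mu> + c\<^sup>2) has_real_derivative 4) (at \<mu>)"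
        by (auto intro!: derivative_eq_intros)
      ultimately have "((\<lambda>\<mu>. sqrt (4 * \<mu> + c\<^sup>2) / 2 - c / 2) has_real_derivative
          inverse (sqrt (4 * \<mu> + c\<^sup>2)) / 2 * 4 / 2 - 0) (at \<mu>)"
        by (intro DERIV_diff DERIV_cdivide DERIV_const DERIV_chain2[OF DERIV_real_sqrt])
      then show ?thesis by (rule DERIV_cong) (simp add: s_def inverse_eq_divide)
    qed
    then show ?thesis by (simp add: lam_def[abs_def] c_def)
  qed
  then have d: "deriv (lam n k) \<mu> = 1 / s" by (rule DERIV_imp_deriv)
  show "0 < deriv (lam n k) \<mu>" using sc c by (simp add: d)
  show "deriv (lam n k) \<mu> \<le> 1 / (real k + 1)" unfolding d using sc c by (intro divide_left_mono) auto
qed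

text \<open>A crude bound on the Laguerre polynomial is enough because \<open>k \<lambda>\<^sub>k(\<mu>)\<close> stays bounded by \<open>\<mu>\<close>; the
  resulting growth in \<open>v\<close> is absorbed by the Gaussian factor of the test function.\<close>

lemma phi_lam_bound:
  assumes \<mu>: "\<mu> > 0" and n: "n \<ge> 1"
  shows "\<bar>phi n k (lam n k \<mu>) v\<bar> \<le> (real k + 1) ^ (n - 1) * exp (\<mu> * (norm v)\<^sup>2 / 2)"
proof -
  note l = lam_props[OF \<mu> n, of k]
  let ?x = "lam n k \<mu> * (norm v)\<^sup>2 / 2"
  have "(real k + 1) * lam n k \<mu> \<le> \<mu>" using l(3) by (simp add: field_simps)
  then have "(real k + 1) * lam n k \<mu> * ((norm v)\<^sup>2 / 2) \<le> \<mu> * ((norm v)\<^sup>2 / 2)"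
    by (intro mult_right_mono) auto
  then have x: "(real k + 1) * ?x \<le> \<mu> * (norm v)\<^sup>2 / 2" by (simp add: mult_ac)
  have "\<bar>phi n k (lam n k \<mu>) v\<bar> \<le> \<bar>laguerre (real n - 1) k ?x\<bar> * 1"
    unfolding phi_def abs_mult using l(1) by (intro mult_left_mono) auto
  also have "\<dots> \<le> (real k + 1) ^ (n - 1) * exp ((real k + 1) * ?x)"
    using laguerre_bound[OF n, of ?x k] l(1) by simp
  also have "\<dots> \<le> (real k + 1) ^ (n - 1) * exp (\<mu> * (norm v)\<^sup>2 / 2)"
    using x by (intro mult_left_mono) auto
  finally show ?thesis .
qed

text \<open>Counting powers of k + 1: the weight decays like the power -(n+m), the Laguerre bound
  grows like the power n - 1, and the remaining -(m+1) is at most -2. This makes the series over k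
  converge absolutely.\<close>

lemma weight_bound:
  assumes \<mu>: "\<mu> > 0" and n: "n \<ge> 1" and m: "m \<ge> 1"
  shows "\<bar>lam n k \<mu> ^ (n + m - 1) * deriv (lam n k) \<mu>\<bar> * (real k + 1) ^ (n - 1)
     \<le> \<mu> ^ (n + m - 1) / (real k + 1)\<^sup>2"
proof -
  note l = lam_props[OF \<mu> n, of k]
  define K where "K = real k + 1"
  have K: "K \<ge> 1" by (simp add: K_def)
  have "\<bar>lam n k \<mu> ^ (n + m - 1) * deriv (lam n k) \<mu>\<bar> = lam n k \<mu> ^ (n + m - 1) * deriv (lam n k) \<mu>"
    using l by (intro abs_of_nonneg) auto
  also have "\<dots> \<le> (\<mu> / K) ^ (n + m - 1) * (1 / K)"
    using l \<mu> K by (intro mult_mono power_mono) (auto simp: K_def)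
  finally have "\<bar>lam n k \<mu> ^ (n + m - 1) * deriv (lam n k) \<mu>\<bar> * K ^ (n - 1)
      \<le> (\<mu> / K) ^ (n + m - 1) * (1 / K) * K ^ (n - 1)"
    using K by (intro mult_right_mono) auto
  also have "\<dots> = \<mu> ^ (n + m - 1) / K ^ (m + 1)"
  proof -
    have "n + m - 1 = m + (n - 1)" using n by simp
    then show ?thesis using K by (simp add: power_divide power_add)
  qed
  also have "\<dots> \<le> \<mu> ^ (n + m - 1) / K\<^sup>2"
    using K m \<mu> by (intro divide_left_mono power_increasing) auto
  finally show ?thesis by (simp add: K_def)
qed

section \<open>Convolution of the test function with the joint eigenfunctions\<close>

definition test_fun :: "real \<Rightarrow> 'c::euclidean_space \<Rightarrow> real \<Rightarrow> 'v::euclidean_space \<times> 'c \<Rightarrow> complex" where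
  "test_fun B e \<delta> = (\<lambda>(z, t). of_real (exp (- (B * (norm z)\<^sup>2))) * wave e \<delta> t)"

lemma schwartz_test_fun:
  fixes e :: "'c::euclidean_space"
  assumes "B > 0" "\<delta> > 0"
  shows "schwartz (test_fun B e \<delta> :: 'v::euclidean_space \<times> 'c \<Rightarrow> complex)"
proof -
  define Q :: "'v \<times> 'c \<Rightarrow> complex" where
    "Q = (\<lambda>x. (\<Sum>b\<in>Basis. of_real (- B) * (of_real (x \<bullet> (b, 0)) * of_real (x \<bullet> (b, 0))))
       + (- \<i> * of_real (x \<bullet> (0, e))
       + (\<Sum>b\<in>Basis. of_real (- ((dil e \<delta> b)\<^sup>2 / 2)) * (of_real (x \<bullet> (0, b)) * of_real (x \<bullet> (0, b))))))"
  have Q: "Q (z, t) = - of_real (B * (norm z)\<^sup>2) + (- \<i> * of_real (e \<bullet> t)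
      - of_real ((\<Sum>b\<in>Basis. (dil e \<delta> b * (t \<bullet> b))\<^sup>2) / 2))" for z t
    unfolding Q_def norm_sq_Basis[of z]
    by (simp add: sum_distrib_left sum_divide_distrib sum_negf power_mult_distrib power2_eq_square
        inner_commute[of e] mult_ac)
  have eq: "(test_fun B e \<delta> :: 'v \<times> 'c \<Rightarrow> complex) = (\<lambda>x. exp (Q x))"
  proof
    fix x :: "'v \<times> 'c"
    obtain z t where x: "x = (z, t)" by (cases x)
    have "complex_of_real (exp (- (B * (norm z)\<^sup>2))) = exp (- of_real (B * (norm z)\<^sup>2))"
      by (simp only: exp_of_real[symmetric] of_real_minus)
    then show "test_fun B e \<delta> x = exp (Q x)"
      unfolding x Q exp_add test_fun_def wave_def split_conv by simp
  qed
  \<comment> \<open>The slowest Gaussian rate over all coordinate directions; it depends on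
    \<delta>, which is harmless because only membership in the Schwartz class is at stake.\<close>
  define d where "d = Min (insert B ((\<lambda>b. (dil e \<delta> b)\<^sup>2 / 2) ` Basis))"
  have d: "d > 0" unfolding d_def using assms dil_pos[of \<delta> e]
    by (subst Min_gr_iff) (auto simp: less_imp_neq[symmetric])
  have dB: "d \<le> B" and db: "\<And>b. b \<in> Basis \<Longrightarrow> d \<le> (dil e \<delta> b)\<^sup>2 / 2"
    unfolding d_def by (rule Min_le; simp)+
  have "Re (Q x) \<le> - d * (norm x)\<^sup>2" for x
  proof (cases x)
    case (Pair z t)
    have "d * (norm z)\<^sup>2 \<le> B * (norm z)\<^sup>2" using dB by (intro mult_right_mono) auto
    moreover have "d * (norm t)\<^sup>2 \<le> (\<Sum>b\<in>Basis. (dil e \<delta> b * (t \<bullet> b))\<^sup>2) / 2"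
      unfolding norm_sq_Basis[of t] sum_distrib_left sum_divide_distrib
    proof (rule sum_mono)
      fix b :: 'c assume "b \<in> Basis"
      then have "d * (t \<bullet> b)\<^sup>2 \<le> (dil e \<delta> b)\<^sup>2 / 2 * (t \<bullet> b)\<^sup>2" by (intro mult_right_mono db) auto
      then show "d * (t \<bullet> b)\<^sup>2 \<le> (dil e \<delta> b * (t \<bullet> b))\<^sup>2 / 2" by (simp add: power_mult_distrib)
    qed
    ultimately show ?thesis by (simp add: Pair Q norm_Pair algebra_simps)
  qed
  moreover have "poly_fun Q"
    unfolding Q_def by (intro poly_fun.intros poly_fun_sum) auto
  ultimately show ?thesis unfolding eq using d by (intro schwartz_exp_poly[of Q d]) auto
qed

lemma one_plus_le_exp_square: "1 + r \<le> 2 * exp (r\<^sup>2)" for r :: real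
proof -
  have "0 \<le> (r - 1)\<^sup>2" by simp
  then have "2 * r \<le> r\<^sup>2 + 1" by (simp add: power2_eq_square algebra_simps)
  moreover have "0 \<le> r\<^sup>2" "1 + r\<^sup>2 \<le> exp (r\<^sup>2)" by simp_all
  ultimately show ?thesis by linarith
qed

lemma quadratic_quarter_le:
  fixes a b :: real
  assumes "0 \<le> a" "a \<le> 1" "0 \<le> b"
  shows "a * (a + 2 * b) / 4 \<le> a * (1 + b)"
proof -
  have "a * (a + 2 * b) / 4 \<le> a * (4 * (1 + b)) / 4"
    using assms by (intro divide_right_mono mult_left_mono) simp_all
  also have "\<dots> = a * (1 + b)" by (simp add: algebra_simps)
  finally show ?thesis .
qed

section \<open>The group law in coordinates adapted to the centre\<close>

locale central_bracket =
  fixes br :: "'v::euclidean_space \<times> 'c::euclidean_space \<Rightarrow> 'v \<times> 'c \<Rightarrow> 'v \<times> 'c"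
  assumes bil: "bilinear br" and alt: "\<And>x. br x x = 0"
    and two_step: "\<And>x y z. br (br x y) z = 0" and center: "lie_center br = {0} \<times> UNIV"
begin

definition om :: "'v \<Rightarrow> 'v \<Rightarrow> 'c" where "om w z = snd (br (w, 0) (z, 0))"

text \<open>Central components drop out of the bracket, on the right via the antisymmetry obtained
  by polarising \<open>alt\<close>; the value lies in the centre by two-step nilpotency and hence
  has first component 0.\<close>

lemma br_eq_om: "br (w, s) (z, t) = (0, om w z)"
proof -
  have anti: "br x y = - br y x" for x y
  proof -
    have "0 = br (x + y) (x + y)" by (simp add: alt)
    also have "\<dots> = br x y + br y x"
      unfolding bilinear_ladd[OF bil] bilinear_radd[OF bil] by (simp add: alt)
    finally show ?thesis by (simp add: eq_neg_iff_add_eq_0)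
  qed
  have c: "br (0, s) y = 0" for s y
  proof -
    have "(0, s) \<in> lie_center br" unfolding center by simp
    then show ?thesis by (simp only: lie_center_def mem_Collect_eq)
  qed
  have "br (w, s) (z, t) = br ((w, 0) + (0, s)) ((z, 0) + (0, t))" by simp
  also have "\<dots> = br (w, 0) (z, 0) + br (w, 0) (0, t)"
    using bil by (simp only: bilinear_ladd bilinear_radd c add_0_right)
  also have "br (w, 0) (0, t) = 0" by (subst anti) (simp add: c)
  finally have 1: "br (w, s) (z, t) = br (w, 0) (z, 0)" by simp
  have "br (w, 0) (z, 0) \<in> lie_center br" using two_step by (auto simp: lie_center_def)
  then have "fst (br (w, 0) (z, 0)) = 0" unfolding center by auto
  then show ?thesis unfolding 1 om_def by (simp add: prod_eq_iff)
qed

lemma gmult_eq: "gmult br (- (w, s)) (z, t) = (z - w, t - s - (1/2) *\<^sub>R om w z)"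
proof -
  have "br (- (w, s)) (z, t) = - br (w, s) (z, t)" using bil by (simp only: bilinear_lneg)
  then show ?thesis by (simp add: gmult_def br_eq_om)
qed

lemma om_bound: "\<exists>K>0. \<forall>w z. norm (om w z) \<le> K * norm w * norm z"
proof -
  obtain K where K: "K > 0" "\<And>x y. norm (br x y) \<le> K * norm x * norm y"
    using bilinear_bounded_pos[OF bil] by blast
  have "norm (om w z) \<le> K * norm w * norm z" for w z
    using K(2)[of "(w, 0)" "(z, 0)"] by (simp add: br_eq_om norm_Pair)
  with K(1) show ?thesis by blast
qed

lemma om_measurable [measurable]: "(\<lambda>w. om w z) \<in> borel_measurable borel"
proof -
  have "linear (\<lambda>w. om w z)"
  proof
    fix x y :: 'v and c :: real
    have "br ((x, 0) + (y, 0)) (z, 0) = br (x, 0) (z, 0) + br (y, 0) (z, 0)"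
      using bil by (rule bilinear_ladd)
    then show "om (x + y) z = om x z + om y z" by (simp add: om_def)
    have "br (c *\<^sub>R (x, 0)) (z, 0) = c *\<^sub>R br (x, 0) (z, 0)"
      using bil by (rule bilinear_lmul)
    then show "om (c *\<^sub>R x) z = c *\<^sub>R om x z" by (simp add: om_def)
  qed
  then show ?thesis
    by (intro borel_measurable_continuous_onI linear_continuous_on) (simp add: linear_conv_bounded_linear)
qed

text \<open>A twisted convolution of the z-Gaussian with a Laguerre function: what remains of the
  group convolution once the central variable is integrated out. The parameter l stands for the norm
  of a and is kept separate so that a known value of that norm can be substituted.\<close>

definition twisted :: "real \<Rightarrow> nat \<Rightarrow> nat \<Rightarrow> real \<Rightarrow> 'c \<Rightarrow> 'v \<Rightarrow> complex" where
  "twisted B n k l a z = (LINT w|lborel.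
     of_real (exp (- (B * (norm w)\<^sup>2)) * phi n k l (z - w)) * exp (\<i> * of_real (a \<bullet> om w z / 2)))"

lemma phi_measurable [measurable]: "phi n k l \<in> borel_measurable (borel :: 'b::euclidean_space measure)"
  unfolding phi_def[abs_def] laguerre_def by measurable

text \<open>The central component of the argument is t - s - \<open>om w z\<close> / 2, so the
  character splits into three factors and the integrand separates in w and s without any change of
  variables. The s-integral is then \<open>wave_fourier\<close>.\<close>

lemma gconv_test_fun:
  assumes e: "e \<in> Basis" and \<delta>: "\<delta> > 0"
    and int: "integrable lborel (\<lambda>w. exp (- (B * (norm w)\<^sup>2)) * phi n k (norm a) (z - w))"
  shows "gconv br (test_fun B e \<delta>) (efun n k a) (z, t) =
     of_real (sqrt (2 * pi) ^ DIM('c) / \<delta> ^ (DIM('c) + 1) * cap_gauss e \<delta> a) *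
     (exp (- \<i> * of_real (a \<bullet> t)) * twisted B n k (norm a) a z)"
proof -
  let ?g = "\<lambda>w. of_real (exp (- (B * (norm w)\<^sup>2)) * phi n k (norm a) (z - w)) *
     exp (\<i> * of_real (a \<bullet> om w z / 2)) :: complex"
  let ?h = "\<lambda>s. wave e \<delta> s * exp (\<i> * of_real (a \<bullet> s))"
  have g: "integrable lborel ?g"
    by (rule Bochner_Integration.integrable_bound[OF int]) (auto simp: norm_mult)
  have h: "has_bochner_integral lborel ?h
      (of_real (sqrt (2 * pi) ^ DIM('c) / \<delta> ^ (DIM('c) + 1) * cap_gauss e \<delta> a))"
    by (rule wave_fourier[OF e \<delta>])
  have "test_fun B e \<delta> y * efun n k a (gmult br (- y) (z, t))
      = exp (- \<i> * of_real (a \<bullet> t)) * (case y of (w, s) \<Rightarrow> ?g w * ?h s)" for y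
  proof (cases y)
    case (Pair w s)
    have "efun n k a (gmult br (- y) (z, t)) = exp (- \<i> * of_real (a \<bullet> t)) *
       (exp (\<i> * of_real (a \<bullet> s)) * exp (\<i> * of_real (a \<bullet> om w z / 2))) * of_real (phi n k (norm a) (z - w))"
      unfolding Pair gmult_eq efun_def
      by (simp add: inner_diff_right algebra_simps flip: exp_add)
    then show ?thesis by (simp add: Pair test_fun_def mult_ac)
  qed
  then have "gconv br (test_fun B e \<delta>) (efun n k a) (z, t)
      = (LINT y|lborel. exp (- \<i> * of_real (a \<bullet> t)) * (case y of (w, s) \<Rightarrow> ?g w * ?h s))"
    unfolding gconv_def by simp
  also have "\<dots> = exp (- \<i> * of_real (a \<bullet> t)) * ((LINT w|lborel. ?g w) * (LINT s|lborel. ?h s))"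
    using has_bochner_integral_pair_mult[OF g, of ?h] h
    by (simp add: has_bochner_integral_iff)
  finally show ?thesis using h by (simp add: has_bochner_integral_iff twisted_def mult_ac)
qed

text \<open>The estimate |z - w|^2 \<le> 2|z|^2 + 2|w|^2 splits the growth exp(\<mu>|z - w|^2 / 2)
  of the Laguerre functions into exp(\<mu>|z|^2) exp(\<mu>|w|^2). The Gaussian absorbs the second
  factor exactly when B > \<mu>, uniformly in k.\<close>

lemma
  assumes \<mu>: "\<mu> > 0" and n: "n \<ge> 1" and B: "B > \<mu>"
  shows integrable_twisted_lam:
      "integrable lborel (\<lambda>w. exp (- (B * (norm w)\<^sup>2)) * phi n k (lam n k \<mu>) (z - w :: 'v))"
    and twisted_lam_bound: "norm (twisted B n k (lam n k \<mu>) a z)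
      \<le> (real k + 1) ^ (n - 1) * (exp (\<mu> * (norm z)\<^sup>2) * (LINT w|lborel. exp (- ((B - \<mu>) * (norm (w::'v))\<^sup>2))))"
proof -
  let ?C = "(real k + 1) ^ (n - 1) * exp (\<mu> * (norm z)\<^sup>2)"
  have le: "\<bar>exp (- (B * (norm w)\<^sup>2)) * phi n k (lam n k \<mu>) (z - w)\<bar> \<le> ?C * exp (- ((B - \<mu>) * (norm w)\<^sup>2))"
    for w :: 'v
  proof -
    have "(norm (z - w))\<^sup>2 \<le> (norm z + norm w)\<^sup>2" by (intro power_mono norm_triangle_ineq4) auto
    also have "\<dots> \<le> 2 * (norm z)\<^sup>2 + 2 * (norm w)\<^sup>2"
      using zero_le_power2[of "norm z - norm w"] by (simp add: power2_eq_square algebra_simps)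
    finally have "\<mu> * (norm (z - w))\<^sup>2 / 2 \<le> \<mu> * (2 * (norm z)\<^sup>2 + 2 * (norm w)\<^sup>2) / 2"
      using \<mu> by (intro divide_right_mono mult_left_mono) auto
    then have 1: "exp (\<mu> * (norm (z - w))\<^sup>2 / 2) \<le> exp (\<mu> * (norm z)\<^sup>2) * exp (\<mu> * (norm w)\<^sup>2)"
      by (simp add: algebra_simps flip: exp_add)
    have "\<bar>exp (- (B * (norm w)\<^sup>2)) * phi n k (lam n k \<mu>) (z - w)\<bar>
        \<le> exp (- (B * (norm w)\<^sup>2)) * ((real k + 1) ^ (n - 1) * exp (\<mu> * (norm (z - w))\<^sup>2 / 2))"
      unfolding abs_mult using phi_lam_bound[OF \<mu> n, of k "z - w"] by (intro mult_mono) auto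
    also have "\<dots> \<le> exp (- (B * (norm w)\<^sup>2)) * ((real k + 1) ^ (n - 1) * (exp (\<mu> * (norm z)\<^sup>2) * exp (\<mu> * (norm w)\<^sup>2)))"
      using 1 by (intro mult_left_mono) auto
    also have "\<dots> = ?C * exp (- ((B - \<mu>) * (norm w)\<^sup>2))"
      by (simp add: algebra_simps flip: exp_add)
    finally show ?thesis .
  qed
  have G: "integrable lborel (\<lambda>w::'v. ?C * exp (- ((B - \<mu>) * (norm w)\<^sup>2)))"
    using gaussian_integral[of "B - \<mu>", where 'a='v] B
    by (intro integrable_mult_right) (simp add: has_bochner_integral_iff)
  show int: "integrable lborel (\<lambda>w. exp (- (B * (norm w)\<^sup>2)) * phi n k (lam n k \<mu>) (z - w :: 'v))"
    by (rule Bochner_Integration.integrable_bound[OF G]) (use le in auto)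
  have "norm (twisted B n k (lam n k \<mu>) a z)
      \<le> (LINT w|lborel. norm (of_real (exp (- (B * (norm w)\<^sup>2)) * phi n k (lam n k \<mu>) (z - w)) *
           exp (\<i> * of_real (a \<bullet> om w z / 2)) :: complex))"
    unfolding twisted_def by (rule integral_norm_bound)
  also have "\<dots> = (LINT w|lborel. \<bar>exp (- (B * (norm w)\<^sup>2)) * phi n k (lam n k \<mu>) (z - w)\<bar>)"
    by (simp add: norm_mult abs_mult)
  also have "\<dots> \<le> (LINT w|lborel. ?C * exp (- ((B - \<mu>) * (norm (w::'v))\<^sup>2)))"
    by (rule integral_mono) (use int G le in auto)
  finally show "norm (twisted B n k (lam n k \<mu>) a z)
      \<le> (real k + 1) ^ (n - 1) * (exp (\<mu> * (norm z)\<^sup>2) * (LINT w|lborel. exp (- ((B - \<mu>) * (norm (w::'v))\<^sup>2))))"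
    by (simp add: mult_ac)
qed

lemma integrable_twisted_0:
  assumes "B > 0" "l \<ge> 0"
  shows "integrable lborel (\<lambda>w. exp (- (B * (norm w)\<^sup>2)) * phi n 0 l (z - w :: 'v))"
proof (rule Bochner_Integration.integrable_bound)
  show "integrable lborel (\<lambda>w::'v. exp (- (B * (norm w)\<^sup>2)))"
    using gaussian_integral[of B, where 'a='v] assms by (simp add: has_bochner_integral_iff)
qed (use assms in \<open>auto simp: phi_0\<close>)

text \<open>The leading term is estimated from below, so its spherical integral must be a genuine
  one; this supplies the measurability in a.\<close>

lemma twisted_0_measurable [measurable]: "(\<lambda>a. twisted B n 0 (norm a) a z) \<in> borel_measurable borel"
  unfolding twisted_def phi_0 by measurable

text \<open>At z = 0 the phase disappears and the integrand is exp(- (B + 1/4)|w|^2), whatever the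
  direction of a. For small z both the phase and the shifted Gaussian change by O(|z|(1 + |w|)).
  Bounding 1 + |w| by 2 exp(|w|^2) lowers the rate from B to B - 1, hence the condition B >
  1.\<close>

lemma twisted_0_near:
  assumes B: "B > 1"
  shows "\<exists>C>0. \<forall>a z. norm a = 1 \<longrightarrow> norm z \<le> 1 \<longrightarrow>
     norm (twisted B n 0 1 a z - of_real (LINT w|lborel. exp (- ((B + 1/4) * (norm (w::'v))\<^sup>2)))) \<le> C * norm z"
proof -
  obtain K where K: "K > 0" "\<And>w z. norm (om w z) \<le> K * norm w * norm z" using om_bound by blast
  define I where "I = (LINT w|lborel. exp (- ((B - 1) * (norm (w::'v))\<^sup>2)))"
  have GI: "has_bochner_integral lborel (\<lambda>w. exp (- ((B - 1) * (norm (w::'v))\<^sup>2))) I"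
    using gaussian_integral[of "B - 1", where 'a='v] B by (simp add: I_def has_bochner_integral_iff)
  have I0: "I > 0" unfolding I_def
    using gaussian_integral[of "B - 1", where 'a='v] B by (simp add: has_bochner_integral_iff)
  have exp_lip: "\<bar>exp (- x) - exp (- y)\<bar> \<le> \<bar>x - y\<bar>" if "x \<ge> 0" "y \<ge> 0" for x y :: real
  proof -
    have *: "exp (- x) - exp (- y) \<le> y - x" if "0 \<le> x" "x \<le> y" for x y :: real
    proof -
      have "exp (- x) - exp (- y) = exp (- x) * (1 - exp (x - y))"
        by (simp add: algebra_simps flip: exp_add)
      also have "1 - exp (x - y) \<le> y - x" using exp_ge_add_one_self[of "x - y"] by linarith
      also have "exp (- x) * (y - x) \<le> 1 * (y - x)" using that by (intro mult_right_mono) auto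
      finally show ?thesis by simp
    qed
    show ?thesis using *[of x y] *[of y x] that by (cases "x \<le> y") auto
  qed
  have iexp1: "norm (exp (\<i> * of_real \<theta>) - 1) \<le> \<bar>\<theta>\<bar>" for \<theta> :: real
    using iexp_approx1[of \<theta> 0] by simp
  \<comment> \<open>K accounts for the phase, 1 for the shift of the Gaussian, and 2 comes from
    \<open>one_plus_le_exp_square\<close>.\<close>
  let ?C = "2 * (K + 1)"
  show ?thesis
  proof (intro exI[of _ "?C * I"] conjI allI impI)
    show "?C * I > 0" using K I0 by simp
    fix a :: 'c and z :: 'v assume a: "norm a = 1" and z: "norm z \<le> 1"
    let ?F = "\<lambda>w. of_real (exp (- (B * (norm w)\<^sup>2)) * phi n 0 1 (z - w)) * exp (\<i> * of_real (a \<bullet> om w z / 2)) :: complex"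
    let ?A = "\<lambda>w::'v. exp (- ((B + 1/4) * (norm w)\<^sup>2))"
    have le: "norm (?F w - of_real (?A w)) \<le> ?C * norm z * exp (- ((B - 1) * (norm w)\<^sup>2))" for w
    proof -
      define E where "E = exp (\<i> * of_real (a \<bullet> om w z / 2))"
      have A: "?A w = exp (- (B * (norm w)\<^sup>2)) * exp (- ((norm w)\<^sup>2 / 4))"
        by (simp add: algebra_simps flip: exp_add)
      have "?F w - of_real (?A w) = of_real (exp (- (B * (norm w)\<^sup>2))) *
         (of_real (exp (- ((norm (z - w))\<^sup>2 / 4))) * (E - 1)
          + of_real (exp (- ((norm (z - w))\<^sup>2 / 4)) - exp (- ((norm w)\<^sup>2 / 4))))"
        unfolding A phi_0 E_def[symmetric] by (simp add: algebra_simps)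
      then have "norm (?F w - of_real (?A w)) = exp (- (B * (norm w)\<^sup>2)) *
         norm (of_real (exp (- ((norm (z - w))\<^sup>2 / 4))) * (E - 1)
          + of_real (exp (- ((norm (z - w))\<^sup>2 / 4)) - exp (- ((norm w)\<^sup>2 / 4))))"
        by (simp add: norm_mult del: of_real_diff of_real_exp)
      also have "\<dots> \<le> exp (- (B * (norm w)\<^sup>2)) * (norm z * (K + 1) * (1 + norm w))"
      proof (intro mult_left_mono)
        have "norm (of_real (exp (- ((norm (z - w))\<^sup>2 / 4))) * (E - 1)) \<le> 1 * norm (E - 1)"
          unfolding norm_mult by (intro mult_right_mono) auto
        also have "\<dots> \<le> \<bar>a \<bullet> om w z / 2\<bar>" using iexp1[of "a \<bullet> om w z / 2"] by (simp add: E_def)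
        also have "\<dots> \<le> \<bar>a \<bullet> om w z\<bar>" by simp
        also have "\<dots> \<le> norm a * norm (om w z)" by (rule Cauchy_Schwarz_ineq2)
        also have "\<dots> \<le> K * norm w * norm z" using K(2) a by simp
        finally have 1: "norm (of_real (exp (- ((norm (z - w))\<^sup>2 / 4))) * (E - 1)) \<le> K * norm w * norm z" .
        have "\<bar>exp (- ((norm (z - w))\<^sup>2 / 4)) - exp (- ((norm w)\<^sup>2 / 4))\<bar>
            \<le> \<bar>(norm (z - w))\<^sup>2 / 4 - (norm w)\<^sup>2 / 4\<bar>" by (rule exp_lip) auto
        also have "\<dots> = \<bar>norm (z - w) - norm w\<bar> * (norm (z - w) + norm w) / 4"
          by (simp add: power2_eq_square square_diff_square_factored abs_mult flip: diff_divide_distrib)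
        also have "\<dots> \<le> norm z * (norm z + 2 * norm w) / 4"
        proof (intro divide_right_mono mult_mono)
          show "\<bar>norm (z - w) - norm w\<bar> \<le> norm z"
            using norm_triangle_ineq3[of "w - z" w] by (simp add: norm_minus_commute)
          show "norm (z - w) + norm w \<le> norm z + 2 * norm w"
            using norm_triangle_ineq4[of z w] by simp
        qed auto
        also have "\<dots> \<le> norm z * (1 + norm w)"
          using z by (intro quadratic_quarter_le) auto
        finally have 2: "\<bar>exp (- ((norm (z - w))\<^sup>2 / 4)) - exp (- ((norm w)\<^sup>2 / 4))\<bar> \<le> norm z * (1 + norm w)" .
        have 3: "K * norm w * norm z \<le> K * (1 + norm w) * norm z"
          using K by (intro mult_right_mono mult_left_mono) auto
        show "norm (of_real (exp (- ((norm (z - w))\<^sup>2 / 4))) * (E - 1)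
          + of_real (exp (- ((norm (z - w))\<^sup>2 / 4)) - exp (- ((norm w)\<^sup>2 / 4)))) \<le> norm z * (K + 1) * (1 + norm w)"
          by (rule norm_triangle_le) (use 1 2 3 in \<open>simp add: algebra_simps del: of_real_diff of_real_exp\<close>)
      qed auto
      also have "\<dots> \<le> exp (- (B * (norm w)\<^sup>2)) * (norm z * (K + 1) * (2 * exp ((norm w)\<^sup>2)))"
      proof (intro mult_left_mono)
        show "1 + norm w \<le> 2 * exp ((norm w)\<^sup>2)" by (rule one_plus_le_exp_square)
      qed (use K in auto)
      also have "\<dots> = ?C * norm z * exp (- ((B - 1) * (norm w)\<^sup>2))"
        by (simp add: algebra_simps flip: exp_add)
      finally show ?thesis .
    qed
    have iF: "integrable lborel ?F"
      by (rule Bochner_Integration.integrable_bound[OF integrable_twisted_0[of B 1 n z]])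
        (use B in \<open>auto simp: norm_mult\<close>)
    have iA0: "integrable lborel ?A"
      using gaussian_integral[of "B + 1/4", where 'a='v] B by (simp add: has_bochner_integral_iff)
    then have iA: "integrable lborel (\<lambda>w. complex_of_real (?A w))" by (rule integrable_of_real)
    have A: "of_real (LINT w|lborel. ?A w) = (LINT w|lborel. complex_of_real (?A w))"
      by (rule integral_complex_of_real[symmetric])
    have eq: "twisted B n 0 1 a z - of_real (LINT w|lborel. ?A w) = (LINT w|lborel. ?F w - of_real (?A w))"
      unfolding twisted_def A by (rule Bochner_Integration.integral_diff[symmetric, OF iF iA])
    have "norm (twisted B n 0 1 a z - of_real (LINT w|lborel. ?A w))
        \<le> (LINT w|lborel. norm (?F w - of_real (?A w)))"
      unfolding eq by (rule integral_norm_bound)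
    also have "\<dots> \<le> (LINT w|lborel. ?C * norm z * exp (- ((B - 1) * (norm (w::'v))\<^sup>2)))"
    proof (rule integral_mono)
      show "integrable lborel (\<lambda>w. norm (?F w - of_real (?A w)))"
        by (intro integrable_norm Bochner_Integration.integrable_diff iF iA)
      show "integrable lborel (\<lambda>w::'v. ?C * norm z * exp (- ((B - 1) * (norm w)\<^sup>2)))"
        using GI by (intro integrable_mult_right) (simp only: has_bochner_integral_iff)
    qed (rule le)
    also have "\<dots> = ?C * norm z * I" using GI by (simp only: has_bochner_integral_iff integral_mult_right_zero)
    finally show "norm (twisted B n 0 1 a z - of_real (LINT w|lborel. ?A w)) \<le> ?C * I * norm z"
      by (simp add: mult_ac)
  qed
qed

end

section \<open>Lower bound for the restriction operator\<close>

lemma inner_sum_le: "\<bar>x \<bullet> y\<bar> \<le> (\<Sum>b\<in>Basis. \<bar>x \<bullet> b\<bar> * \<bar>y \<bullet> b\<bar>)" for x y :: "'a::euclidean_space"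
  using sum_abs[of "\<lambda>b. (x \<bullet> b) * (y \<bullet> b)" Basis] by (simp add: euclidean_inner[of x y] abs_mult)

context central_bracket
begin

text \<open>After multiplication by the unimodular constant exp(\<i> e \<bullet> t) the integrand
  differs from the positive function A * \<open>cap_gauss\<close> by at most \<rho> (C + A m)
  \<open>tang_gauss\<close>. Both Gaussians have spherical integrals of order \<delta>^(m-1), so a
  small \<rho> independent of \<delta> rules out cancellation.\<close>

lemma leading_term_lower:
  assumes B: "B > 1" and e: "e \<in> Basis"
  obtains \<kappa> \<rho> where
    "\<forall>\<delta> z t. 0 < \<delta> \<longrightarrow> \<delta> \<le> 1 \<longrightarrow> norm z \<le> \<rho> \<longrightarrow> (\<forall>b\<in>Basis. \<bar>t \<bullet> b\<bar> \<le> \<rho> / dil e \<delta> b) \<longrightarrow>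
     \<kappa> * \<delta> ^ (DIM('c) - 1) \<le> norm (LINT a|sphere_measure. of_real (cap_gauss e \<delta> a) *
        (exp (- \<i> * of_real (a \<bullet> t)) * twisted B n 0 (norm a) a z))"
    "\<kappa> > 0" "\<rho> > 0" "\<rho> \<le> 1"
proof -
  define m where "m = real DIM('c)"
  have m: "m \<ge> 1" using DIM_positive[where 'a='c] by (simp add: m_def Suc_leI)
  define A where "A = (LINT w|lborel. exp (- ((B + 1/4) * (norm (w::'v))\<^sup>2)))"
  have A: "A > 0" unfolding A_def
    using gaussian_integral[of "B + 1/4", where 'a='v] B by (simp add: has_bochner_integral_iff)
  obtain C where C: "C > 0" "\<And>a z. norm a = 1 \<Longrightarrow> norm z \<le> 1 \<Longrightarrow> norm (twisted B n 0 1 a z - of_real A) \<le> C * norm z"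
    using twisted_0_near[OF B] unfolding A_def by blast
  define c\<^sub>1 where "c\<^sub>1 = m * exp (- m) / 4 * (1 / (2 * m)) ^ (DIM('c) - 1)"
  define c\<^sub>2 where "c\<^sub>2 = 2 * m * (sqrt (2 * pi) * sqrt 2) ^ (DIM('c) - 1)"
  have c: "c\<^sub>1 > 0" "c\<^sub>2 > 0" using m by (auto simp: c\<^sub>1_def c\<^sub>2_def)
  define D where "D = (C + A * m) * c\<^sub>2"
  have D: "D > 0" using C A m c by (simp add: D_def add_pos_pos)
  \<comment> \<open>Chosen so that the error \<rho> D is at most half of the main term A *
    \<open>c\<^sub>1\<close>; the cap at 1 keeps z in the range of
    \<open>twisted_0_near\<close>.\<close>
  define \<rho> where "\<rho> = min 1 (A * c\<^sub>1 / (2 * D))"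
  have \<rho>: "\<rho> > 0" "\<rho> \<le> 1" "\<rho> * D \<le> A * c\<^sub>1 / 2"
  proof -
    show "\<rho> > 0" "\<rho> \<le> 1" using A c D by (auto simp: \<rho>_def)
    have "\<rho> \<le> A * c\<^sub>1 / (2 * D)" by (simp add: \<rho>_def)
    then show "\<rho> * D \<le> A * c\<^sub>1 / 2" using D by (simp add: field_simps)
  qed
  have main: "A * c\<^sub>1 / 2 * \<delta> ^ (DIM('c) - 1) \<le> norm (LINT a|sphere_measure. of_real (cap_gauss e \<delta> a) *
        (exp (- \<i> * of_real (a \<bullet> t)) * twisted B n 0 (norm a) a z))"
    if \<delta>: "0 < \<delta>" "\<delta> \<le> 1" and z: "norm z \<le> \<rho>" and t: "\<And>b. b \<in> Basis \<Longrightarrow> \<bar>t \<bullet> b\<bar> \<le> \<rho> / dil e \<delta> b"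
    for \<delta> z t
  proof -
    define G where "G a = of_real (cap_gauss e \<delta> a) * (exp (- \<i> * of_real (a \<bullet> t)) * twisted B n 0 (norm a) a z)" for a
    have Gm [measurable]: "G \<in> borel_measurable borel" unfolding G_def[abs_def] by measurable
    have tw: "norm (twisted B n 0 1 a z) \<le> A + C" if "norm a = 1" for a
    proof -
      have "norm (twisted B n 0 1 a z) \<le> norm (complex_of_real A) + norm (twisted B n 0 1 a z - of_real A)"
        using norm_triangle_ineq[of "of_real A" "twisted B n 0 1 a z - of_real A"] by simp
      also have "norm (twisted B n 0 1 a z - of_real A) \<le> C * norm z" using C(2) that z \<rho> by auto
      also have "C * norm z \<le> C * 1" using C z \<rho> by (intro mult_left_mono) auto
      finally show ?thesis using A by simp
    qed
    have Gi: "integrable sphere_measure G"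
    proof (rule integrable_sphere_bounded[OF Gm])
      fix a :: 'c assume a: "norm a = 1"
      have "norm (G a) = cap_gauss e \<delta> a * norm (twisted B n 0 1 a z)"
        using gauss_bounds(1)[of e \<delta> a] a by (simp add: G_def norm_mult)
      also have "\<dots> \<le> 1 * (A + C)" by (intro mult_mono gauss_bounds tw a) auto
      finally show "norm (G a) \<le> 1 * (A + C)" .
    qed
    have capi: "integrable sphere_measure (cap_gauss e \<delta>)" and tangi: "integrable sphere_measure (tang_gauss e \<delta>)"
      by (rule integrable_sphere_bounded[of _ 1]; auto simp: gauss_bounds)+
    have le: "norm (exp (\<i> * of_real (e \<bullet> t)) * G a - of_real A * of_real (cap_gauss e \<delta> a))
        \<le> \<rho> * (C + A * m) * tang_gauss e \<delta> a" if a: "norm a = 1" for a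
    proof -
      define E where "E = exp (\<i> * of_real (- ((a - e) \<bullet> t)))"
      have nE: "norm E = 1" by (simp add: E_def)
      have "exp (\<i> * of_real (e \<bullet> t)) * G a = of_real (cap_gauss e \<delta> a) * (E * twisted B n 0 1 a z)"
        unfolding G_def E_def using a by (simp add: inner_diff_left algebra_simps flip: exp_add)
      then have "exp (\<i> * of_real (e \<bullet> t)) * G a - of_real A * of_real (cap_gauss e \<delta> a)
          = of_real (cap_gauss e \<delta> a) * (E * (twisted B n 0 1 a z - of_real A) + of_real A * (E - 1))"
        by (simp add: algebra_simps)
      then have "norm (exp (\<i> * of_real (e \<bullet> t)) * G a - of_real A * of_real (cap_gauss e \<delta> a))
          = cap_gauss e \<delta> a * norm (E * (twisted B n 0 1 a z - of_real A) + of_real A * (E - 1))"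
        using gauss_bounds(1)[of e \<delta> a] by (simp add: norm_mult)
      also have "\<dots> \<le> cap_gauss e \<delta> a * (C * \<rho> + A * (\<rho> * (\<Sum>b\<in>Basis. \<bar>(a - e) \<bullet> b\<bar> / dil e \<delta> b)))"
      proof (intro mult_left_mono gauss_bounds norm_triangle_le add_mono)
        have "norm (E * (twisted B n 0 1 a z - of_real A)) \<le> C * norm z"
          using C(2)[OF a] z \<rho> nE by (simp add: norm_mult)
        also have "\<dots> \<le> C * \<rho>" using z C by (intro mult_left_mono) auto
        finally show "norm (E * (twisted B n 0 1 a z - of_real A)) \<le> C * \<rho>" .
        \<comment> \<open>Duality of box and cap: the phase (a - e) \<bullet> t is at most \<rho>
          times the l1 size of a - e in cap units, so it is small where \<open>cap_gauss\<close> is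
          concentrated.\<close>
        have "norm (E - 1) \<le> \<bar>(a - e) \<bullet> t\<bar>"
          using iexp_approx1[of "- ((a - e) \<bullet> t)" 0] by (simp add: E_def)
        also have "\<dots> \<le> (\<Sum>b\<in>Basis. \<bar>(a - e) \<bullet> b\<bar> * \<bar>t \<bullet> b\<bar>)" by (rule inner_sum_le)
        also have "\<dots> \<le> (\<Sum>b\<in>Basis. \<bar>(a - e) \<bullet> b\<bar> * (\<rho> / dil e \<delta> b))"
          by (intro sum_mono mult_left_mono t) auto
        also have "\<dots> = \<rho> * (\<Sum>b\<in>Basis. \<bar>(a - e) \<bullet> b\<bar> / dil e \<delta> b)"
          by (simp add: sum_distrib_left mult_ac)
        finally show "norm (of_real A * (E - 1)) \<le> A * (\<rho> * (\<Sum>b\<in>Basis. \<bar>(a - e) \<bullet> b\<bar> / dil e \<delta> b))"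
          using A by (simp add: norm_mult)
      qed
      also have "\<dots> = C * \<rho> * cap_gauss e \<delta> a + A * \<rho> * (cap_gauss e \<delta> a * (\<Sum>b\<in>Basis. \<bar>(a - e) \<bullet> b\<bar> / dil e \<delta> b))"
        by (simp add: algebra_simps)
      also have "\<dots> \<le> C * \<rho> * tang_gauss e \<delta> a + A * \<rho> * (m * tang_gauss e \<delta> a)"
        unfolding m_def using cap_le_tang[OF e \<delta>(1)] C A \<rho> by (intro add_mono mult_left_mono) auto
      finally show ?thesis by (simp add: algebra_simps)
    qed
    have "norm (exp (\<i> * of_real (e \<bullet> t)) * (LINT a|sphere_measure. G a)
          - of_real A * of_real (LINT a|sphere_measure. cap_gauss e \<delta> a))
        = norm (LINT a|sphere_measure. exp (\<i> * of_real (e \<bullet> t)) * G a - of_real A * of_real (cap_gauss e \<delta> a))"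
      using Gi capi by simp
    also have "\<dots> \<le> (LINT a|sphere_measure. norm (exp (\<i> * of_real (e \<bullet> t)) * G a - of_real A * of_real (cap_gauss e \<delta> a)))"
      by (rule integral_norm_bound)
    also have "\<dots> \<le> (LINT a|sphere_measure. \<rho> * (C + A * m) * tang_gauss e \<delta> a)"
      by (rule integral_mono_AE) (use Gi capi tangi AE_sphere le in auto)
    also have "\<dots> \<le> \<rho> * (C + A * m) * (c\<^sub>2 * \<delta> ^ (DIM('c) - 1))"
      using tang_gauss_integral_upper[OF e \<delta>(1)] \<rho> C A m
      by (auto simp: c\<^sub>2_def m_def intro!: mult_left_mono add_nonneg_nonneg)
    also have "\<dots> = \<rho> * D * \<delta> ^ (DIM('c) - 1)" by (simp add: D_def mult_ac)
    also have "\<dots> \<le> A * c\<^sub>1 / 2 * \<delta> ^ (DIM('c) - 1)"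
      using \<delta> \<rho> by (intro mult_right_mono) auto
    finally have 1: "norm (exp (\<i> * of_real (e \<bullet> t)) * (LINT a|sphere_measure. G a)
          - of_real A * of_real (LINT a|sphere_measure. cap_gauss e \<delta> a)) \<le> A * c\<^sub>1 / 2 * \<delta> ^ (DIM('c) - 1)" .
    have 2: "norm (complex_of_real A * of_real (LINT a|sphere_measure. cap_gauss e \<delta> a)) \<ge> A * (c\<^sub>1 * \<delta> ^ (DIM('c) - 1))"
    proof -
      have "c\<^sub>1 * \<delta> ^ (DIM('c) - 1) \<le> (LINT a|sphere_measure. cap_gauss e \<delta> a)"
        using cap_gauss_integral_lower[OF e \<delta>] by (simp add: c\<^sub>1_def m_def)
      then have "A * (c\<^sub>1 * \<delta> ^ (DIM('c) - 1)) \<le> A * \<bar>LINT a|sphere_measure. cap_gauss e \<delta> a\<bar>"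
        using A by (intro mult_left_mono) auto
      then show ?thesis using A by (simp add: norm_mult)
    qed
    have "norm (exp (\<i> * of_real (e \<bullet> t)) * (LINT a|sphere_measure. G a)) = norm (LINT a|sphere_measure. G a)"
      by (simp add: norm_mult)
    then show ?thesis
      using 1 2 norm_triangle_ineq2[of "of_real A * of_real (LINT a|sphere_measure. cap_gauss e \<delta> a)"
         "exp (\<i> * of_real (e \<bullet> t)) * (LINT a|sphere_measure. G a)"]
      by (simp add: G_def norm_minus_commute algebra_simps)
  qed
  show ?thesis
    by (rule that[of \<rho> "A * c\<^sub>1 / 2"]) (use A c \<rho> main in auto)
qed

text \<open>The point \<lambda>_k a has e-coordinate at most \<lambda>_k \<le> (n+1)/(n+2). The
  normal summand alone in the exponent of \<open>cap_gauss\<close> then gives the exponentially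
  small factor, with \<delta>^4 as the square of the normal scale.\<close>

lemma higher_term_upper:
  assumes n: "n \<ge> 1" and e: "e \<in> Basis" and \<delta>: "\<delta> > 0" and z: "norm z \<le> 1" and k: "k \<ge> 1"
    and B: "B > real n + 1"
  shows "norm (LINT a|sphere_measure. gconv br (test_fun B e \<delta>) (efun n k (lam n k (real n + 1) *\<^sub>R a)) (z, t))
    \<le> (sqrt (2 * pi) ^ DIM('c) / \<delta> ^ (DIM('c) + 1) * exp (- ((1 / (real n + 2))\<^sup>2 / (2 * \<delta> ^ 4)))) *
       ((real k + 1) ^ (n - 1) * (exp (real n + 1) * (LINT w|lborel. exp (- ((B - (real n + 1)) * (norm (w::'v))\<^sup>2))))) *
       measure (sphere_measure :: 'c measure) UNIV"
proof (rule norm_integral_sphere_le)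
  define \<mu> where "\<mu> = real n + 1"
  define J where "J = (LINT w|lborel. exp (- ((B - \<mu>) * (norm (w::'v))\<^sup>2)))"
  have J: "J \<ge> 0" by (simp add: J_def)
  then show "0 \<le> (sqrt (2 * pi) ^ DIM('c) / \<delta> ^ (DIM('c) + 1) * exp (- ((1 / (real n + 2))\<^sup>2 / (2 * \<delta> ^ 4)))) *
       ((real k + 1) ^ (n - 1) * (exp (real n + 1) * (LINT w|lborel. exp (- ((B - (real n + 1)) * (norm (w::'v))\<^sup>2)))))"
    unfolding J_def \<mu>_def using \<delta> by (intro mult_nonneg_nonneg) auto
  fix a :: 'c assume a: "norm a = 1"
  have \<mu>: "\<mu> > 0" by (simp add: \<mu>_def)
  define l where "l = lam n k \<mu>"
  note lp = lam_props[OF \<mu> n, of k, folded l_def]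
  have nl: "norm (l *\<^sub>R a) = l" using lp a by simp
  have "l \<le> \<mu> / (real n + 2)"
    by (rule order_trans[OF lp(2)]) (use k \<mu> in \<open>auto intro!: divide_left_mono\<close>)
  then have l1: "1 - l \<ge> 1 / (real n + 2)" by (simp add: \<mu>_def field_simps)
  have cap: "cap_gauss e \<delta> (l *\<^sub>R a) \<le> exp (- ((1 / (real n + 2))\<^sup>2 / (2 * \<delta> ^ 4)))"
  proof -
    have "a \<bullet> e \<le> 1" using Basis_le_norm[OF e, of a] a by simp
    then have "l * (a \<bullet> e) \<le> l" using lp(1) by (simp add: mult_left_le)
    then have "1 / (real n + 2) \<le> \<bar>(l *\<^sub>R a - e) \<bullet> e\<bar>" using l1 e by (simp add: inner_diff_left)
    then have "(1 / (real n + 2))\<^sup>2 \<le> ((l *\<^sub>R a - e) \<bullet> e)\<^sup>2"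
      using abs_le_square_iff[of "1 / (real n + 2)" "(l *\<^sub>R a - e) \<bullet> e"] by simp
    then have "(1 / (real n + 2))\<^sup>2 / \<delta> ^ 4 \<le> ((l *\<^sub>R a - e) \<bullet> e)\<^sup>2 / \<delta> ^ 4" by (intro divide_right_mono) auto
    also have "\<dots> = ((l *\<^sub>R a - e) \<bullet> e / dil e \<delta> e)\<^sup>2"
      by (simp add: dil_def power_divide flip: power_mult)
    also have "\<dots> \<le> (\<Sum>b\<in>Basis. ((l *\<^sub>R a - e) \<bullet> b / dil e \<delta> b)\<^sup>2)"
      using e by (intro member_le_sum) auto
    finally show ?thesis by (simp add: cap_gauss_def)
  qed
  have "norm (twisted B n k l (l *\<^sub>R a) z) \<le> (real k + 1) ^ (n - 1) * (exp (\<mu> * (norm z)\<^sup>2) * J)"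
    unfolding l_def J_def by (rule twisted_lam_bound[OF \<mu> n]) (use B in \<open>simp add: \<mu>_def\<close>)
  also have "\<dots> \<le> (real k + 1) ^ (n - 1) * (exp (real n + 1) * J)"
    using z \<mu> J by (intro mult_left_mono mult_right_mono) (auto simp: \<mu>_def power_le_one mult_left_le)
  finally have tw: "norm (twisted B n k l (l *\<^sub>R a) z) \<le> (real k + 1) ^ (n - 1) * (exp (real n + 1) * J)" .
  have "gconv br (test_fun B e \<delta>) (efun n k (l *\<^sub>R a)) (z, t) =
     of_real (sqrt (2 * pi) ^ DIM('c) / \<delta> ^ (DIM('c) + 1) * cap_gauss e \<delta> (l *\<^sub>R a)) *
     (exp (- \<i> * of_real ((l *\<^sub>R a) \<bullet> t)) * twisted B n k l (l *\<^sub>R a) z)"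
    by (rule gconv_test_fun[OF e \<delta>, of B n k "l *\<^sub>R a" z t, unfolded nl])
      (use integrable_twisted_lam[OF \<mu> n, of B k z] B in \<open>simp add: l_def \<mu>_def\<close>)
  then have "norm (gconv br (test_fun B e \<delta>) (efun n k (l *\<^sub>R a)) (z, t)) =
      (sqrt (2 * pi) ^ DIM('c) / \<delta> ^ (DIM('c) + 1) * cap_gauss e \<delta> (l *\<^sub>R a)) * norm (twisted B n k l (l *\<^sub>R a) z)"
    using gauss_bounds(1)[of e \<delta> "l *\<^sub>R a"] \<delta> by (simp add: norm_mult norm_divide norm_power)
  also have "\<dots> \<le> (sqrt (2 * pi) ^ DIM('c) / \<delta> ^ (DIM('c) + 1) * exp (- ((1 / (real n + 2))\<^sup>2 / (2 * \<delta> ^ 4)))) *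
       ((real k + 1) ^ (n - 1) * (exp (real n + 1) * J))"
    using cap tw \<delta> by (intro mult_mono mult_nonneg_nonneg gauss_bounds) auto
  finally show "norm (gconv br (test_fun B e \<delta>) (efun n k (lam n k (real n + 1) *\<^sub>R a)) (z, t))
    \<le> (sqrt (2 * pi) ^ DIM('c) / \<delta> ^ (DIM('c) + 1) * exp (- ((1 / (real n + 2))\<^sup>2 / (2 * \<delta> ^ 4)))) *
       ((real k + 1) ^ (n - 1) * (exp (real n + 1) * (LINT w|lborel. exp (- ((B - (real n + 1)) * (norm (w::'v))\<^sup>2)))))"
    by (simp add: l_def \<mu>_def J_def)
qed

text \<open>The k = 0 term is of order H \<delta>^(m-1), where H is the height of the Fourier
  transform. The tail is bounded by R H \<delta>^m, one power of \<delta> better, so for small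
  \<delta> it takes away at most half of the leading term.\<close>

lemma restriction_op_lower:
  assumes n: "n \<ge> 1" and e: "e \<in> Basis" and B: "B > real n + 1"
  obtains \<kappa> \<rho> \<delta>\<^sub>0 where
    "\<forall>\<delta> z t. 0 < \<delta> \<longrightarrow> \<delta> \<le> \<delta>\<^sub>0 \<longrightarrow> norm z \<le> \<rho> \<longrightarrow> (\<forall>b\<in>Basis. \<bar>t \<bullet> b\<bar> \<le> \<rho> / dil e \<delta> b) \<longrightarrow>
     \<kappa> / \<delta>\<^sup>2 \<le> norm (restriction_op br n (real n + 1) (test_fun B e \<delta>) (z, t))"
    "\<kappa> > 0" "\<rho> > 0" "\<delta>\<^sub>0 > 0"
proof -
  define \<mu> where "\<mu> = real n + 1"
  define m where "m = DIM('c)"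
  have m: "m \<ge> 1" using DIM_positive[where 'a='c] by (simp add: m_def Suc_leI)
  have \<mu>: "\<mu> > 0" by (simp add: \<mu>_def)
  define W where "W k = lam n k \<mu> ^ (n + m - 1) * deriv (lam n k) \<mu>" for k
  have lam0: "lam n 0 \<mu> = 1"
  proof -
    have "4 * \<mu> + (real n)\<^sup>2 = (real n + 2)\<^sup>2" by (simp add: \<mu>_def power2_eq_square algebra_simps)
    then show ?thesis by (simp add: lam_def add_divide_distrib)
  qed
  have W0: "W 0 > 0" using lam_props(4)[OF \<mu> n, of 0] by (simp add: W_def lam0)
  have B1: "B > 1" using B by simp
  obtain \<kappa> \<rho> where
    lead: "\<forall>\<delta> z t. 0 < \<delta> \<longrightarrow> \<delta> \<le> 1 \<longrightarrow> norm z \<le> \<rho> \<longrightarrow>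
     (\<forall>b\<in>Basis. \<bar>t \<bullet> b\<bar> \<le> \<rho> / dil e \<delta> b) \<longrightarrow>
     \<kappa> * \<delta> ^ (m - 1) \<le> norm (LINT a|sphere_measure. of_real (cap_gauss e \<delta> a) *
        (exp (- \<i> * of_real (a \<bullet> t)) * twisted B n 0 (norm a) a z))"
    and \<kappa>: "\<kappa> > 0" and \<rho>: "\<rho> > 0" "\<rho> \<le> 1"
    by (rule leading_term_lower[OF B1 e, of n], rule that[unfolded m_def])
  define M where "M = (exp (real n + 1) * (LINT w|lborel. exp (- ((B - (real n + 1)) * (norm (w::'v))\<^sup>2))))
      * measure (sphere_measure :: 'c measure) UNIV"
  have M: "M \<ge> 0" unfolding M_def by (intro mult_nonneg_nonneg) auto
  have sm: "summable (\<lambda>k. 1 / (real (Suc k) + 1)\<^sup>2)"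
  proof -
    have "summable (\<lambda>k. inverse (real k ^ 2))" by (rule inverse_power_summable) auto
    then have "summable (\<lambda>k. inverse (real (k + 2) ^ 2))" by (rule summable_ignore_initial_segment)
    then show ?thesis by (simp add: inverse_eq_divide add.commute)
  qed
  define Z where "Z = (\<Sum>k. 1 / (real (Suc k) + 1)\<^sup>2)"
  have Z: "Z \<ge> 0" unfolding Z_def using sm by (intro suminf_nonneg) auto
  define d where "d = 1 / (real n + 2)"
  have d: "d > 0" by (simp add: d_def)
  \<comment> \<open>The tail constant: spectral weight, spherical and twisted bounds, the sum over k
    \<ge> 1, and the constant in the power bound for the exponentially small factor. In
    \<open>\<delta>\<^sub>0\<close> the denominator uses R + 1 because R may vanish.\<close>
  define R where "R = \<mu> ^ (n + m - 1) * M * Z * (fact m * (2 / d\<^sup>2) ^ m)"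
  have R: "R \<ge> 0" unfolding R_def using \<mu> M Z by (intro mult_nonneg_nonneg) auto
  define \<delta>\<^sub>0 where "\<delta>\<^sub>0 = min 1 (W 0 * \<kappa> / (2 * (R + 1)))"
  have \<delta>0: "\<delta>\<^sub>0 > 0" "\<delta>\<^sub>0 \<le> 1" "\<delta>\<^sub>0 * R \<le> W 0 * \<kappa> / 2"
  proof -
    show "\<delta>\<^sub>0 > 0" "\<delta>\<^sub>0 \<le> 1" using W0 \<kappa> R by (auto simp: \<delta>\<^sub>0_def)
    have "\<delta>\<^sub>0 * R \<le> W 0 * \<kappa> / (2 * (R + 1)) * (R + 1)"
      using W0 \<kappa> R by (intro mult_mono) (auto simp: \<delta>\<^sub>0_def)
    also have "\<dots> = W 0 * \<kappa> / 2" using R by (simp add: field_simps)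
    finally show "\<delta>\<^sub>0 * R \<le> W 0 * \<kappa> / 2" .
  qed
  have main: "sqrt (2 * pi) ^ m * (W 0 * \<kappa> / 2) / (2 * pi) ^ (n + m) / \<delta>\<^sup>2
      \<le> norm (restriction_op br n \<mu> (test_fun B e \<delta>) (z, t))"
    if \<delta>: "0 < \<delta>" "\<delta> \<le> \<delta>\<^sub>0" and z: "norm z \<le> \<rho>" and t: "\<And>b. b \<in> Basis \<Longrightarrow> \<bar>t \<bullet> b\<bar> \<le> \<rho> / dil e \<delta> b"
    for \<delta> z t
  proof -
    have \<delta>1: "\<delta> \<le> 1" using \<delta> \<delta>0 by simp
    define H where "H = sqrt (2 * pi) ^ m / \<delta> ^ (m + 1)"
    have H: "H > 0" using \<delta> by (simp add: H_def)
    define I where "I k = (LINT a|sphere_measure. gconv br (test_fun B e \<delta>) (efun n k (lam n k \<mu> *\<^sub>R a)) (z, t))" for k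
    define g where "g k = of_real (W k) * I k" for k
    define \<eta> where "\<eta> = exp (- (d\<^sup>2 / (2 * \<delta> ^ 4)))"
    have \<eta>: "\<eta> \<le> fact m * (2 / d\<^sup>2) ^ m * \<delta> ^ m"
    proof -
      let ?x = "d\<^sup>2 / (2 * \<delta> ^ 4)"
      have "?x ^ m \<le> fact m * exp ?x" by (rule power_le_fact_exp) simp
      then have "\<eta> * ?x ^ m \<le> \<eta> * (fact m * exp ?x)" by (intro mult_left_mono) (auto simp: \<eta>_def)
      also have "\<dots> = fact m" by (simp add: \<eta>_def mult.left_commute flip: exp_add)
      finally have "\<eta> \<le> fact m * (1 / ?x) ^ m" using d \<delta> by (simp add: field_simps power_divide)
      also have "1 / ?x = 2 / d\<^sup>2 * \<delta> ^ 4" by simp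
      \<comment> \<open>Decay \<delta>^(4m) is available, but \<delta>^m already beats the cap
        measure \<delta>^(m-1).\<close>
      also have "(2 / d\<^sup>2 * \<delta> ^ 4) ^ m \<le> (2 / d\<^sup>2 * \<delta>) ^ m"
        using \<delta> \<delta>1 power_decreasing[of 1 4 \<delta>] by (intro power_mono mult_left_mono) auto
      finally show ?thesis unfolding power_mult_distrib mult.assoc by simp
    qed
    have gk: "norm (g (Suc k)) \<le> H * \<eta> * M * \<mu> ^ (n + m - 1) * (1 / (real (Suc k) + 1)\<^sup>2)" for k
    proof -
      have "norm (I (Suc k)) \<le> (H * \<eta>) * ((real (Suc k) + 1) ^ (n - 1) * M)"
        using higher_term_upper[OF n e \<delta>(1) _ _ B, of z "Suc k" t] z \<rho>
        unfolding I_def H_def M_def \<eta>_def d_def \<mu>_def m_def by (simp add: mult_ac)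
      then have "norm (g (Suc k)) \<le> \<bar>W (Suc k)\<bar> * ((H * \<eta>) * ((real (Suc k) + 1) ^ (n - 1) * M))"
        unfolding g_def norm_mult by (simp add: mult_left_mono)
      also have "\<dots> = H * \<eta> * M * (\<bar>W (Suc k)\<bar> * (real (Suc k) + 1) ^ (n - 1))" by (simp add: mult_ac)
      also have "\<dots> \<le> H * \<eta> * M * (\<mu> ^ (n + m - 1) / (real (Suc k) + 1)\<^sup>2)"
        using weight_bound[OF \<mu> n m, of "Suc k"] H M
        unfolding W_def by (intro mult_left_mono mult_nonneg_nonneg) (auto simp: \<eta>_def)
      finally show ?thesis by simp
    qed
    have sb: "summable (\<lambda>k. H * \<eta> * M * \<mu> ^ (n + m - 1) * (1 / (real (Suc k) + 1)\<^sup>2))"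
      using sm by (rule summable_mult)
    \<comment> \<open>Actual convergence is needed to split off the term k = 0 from the infinite
      sum.\<close>
    have sg: "summable (\<lambda>k. g (Suc k))" by (rule summable_comparison_test'[OF sb, of 0]) (use gk in auto)
    have \<delta>m: "\<delta> ^ m = \<delta> * \<delta> ^ (m - 1)" using m by (cases m) auto
    have tail: "norm (\<Sum>k. g (Suc k)) \<le> H * \<delta> ^ (m - 1) * (W 0 * \<kappa> / 2)"
    proof -
      have "norm (\<Sum>k. g (Suc k)) \<le> (\<Sum>k. H * \<eta> * M * \<mu> ^ (n + m - 1) * (1 / (real (Suc k) + 1)\<^sup>2))"
        by (rule norm_suminf_le[OF gk sb])
      also have "\<dots> = H * \<eta> * M * \<mu> ^ (n + m - 1) * Z"
        unfolding Z_def by (rule suminf_mult[OF sm])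
      also have "\<dots> = \<eta> * (H * (M * \<mu> ^ (n + m - 1) * Z))" by (simp add: mult_ac)
      also have "\<dots> \<le> (fact m * (2 / d\<^sup>2) ^ m * \<delta> ^ m) * (H * (M * \<mu> ^ (n + m - 1) * Z))"
        using \<eta> H M \<mu> Z by (intro mult_right_mono mult_nonneg_nonneg) auto
      also have "\<dots> = H * \<delta> ^ (m - 1) * (\<delta> * R)"
        by (simp add: R_def \<delta>m mult_ac)
      also have "\<dots> \<le> H * \<delta> ^ (m - 1) * (\<delta>\<^sub>0 * R)"
        using H \<delta> R by (intro mult_left_mono mult_right_mono) auto
      also have "\<dots> \<le> H * \<delta> ^ (m - 1) * (W 0 * \<kappa> / 2)"
        using H \<delta> \<delta>0 by (intro mult_left_mono) auto
      finally show ?thesis .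
    qed
    have B0: "B > 0" using B by simp
    have g0: "W 0 * (H * (\<kappa> * \<delta> ^ (m - 1))) \<le> norm (g 0)"
    proof -
      have "I 0 = (LINT a|sphere_measure. of_real H * (of_real (cap_gauss e \<delta> a) *
          (exp (- \<i> * of_real (a \<bullet> t)) * twisted B n 0 (norm a) a z)))"
        unfolding I_def lam0 scaleR_one gconv_test_fun[OF e \<delta>(1) integrable_twisted_0[OF B0 norm_ge_zero]]
        by (simp add: H_def m_def mult.assoc)
      then have "norm (I 0) = H * norm (LINT a|sphere_measure. (of_real (cap_gauss e \<delta> a) *
          (exp (- \<i> * of_real (a \<bullet> t)) * twisted B n 0 (norm a) a z)))"
        using H by (simp add: norm_mult)
      then have "H * (\<kappa> * \<delta> ^ (m - 1)) \<le> norm (I 0)"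
        using mult_left_mono[OF lead[rule_format, OF \<delta>(1) \<delta>1 z t], of H] H by simp
      then show ?thesis using W0 by (simp add: g_def norm_mult)
    qed
    have "norm (\<Sum>k. g k) = norm (g 0 + (\<Sum>k. g (Suc k)))"
      using suminf_split_head[of g] sg by (simp add: summable_Suc_iff)
    also have "\<dots> \<ge> norm (g 0) - norm (\<Sum>k. g (Suc k))" by (metis diff_minus_eq_add norm_minus_cancel norm_triangle_ineq2)
    finally have "H * \<delta> ^ (m - 1) * (W 0 * \<kappa> / 2) \<le> norm (\<Sum>k. g k)"
      using g0 tail by (simp add: algebra_simps)
    moreover have "H * \<delta> ^ (m - 1) = sqrt (2 * pi) ^ m / \<delta>\<^sup>2"
    proof -
      obtain j where "m = Suc j" using m by (cases m) auto
      then show ?thesis using \<delta> by (simp add: H_def power2_eq_square)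
    qed
    moreover have "norm (restriction_op br n \<mu> (test_fun B e \<delta>) (z, t)) = norm (\<Sum>k. g k) / (2 * pi) ^ (n + m)"
      unfolding restriction_op_def g_def I_def W_def m_def
      by (simp add: norm_mult norm_divide norm_power)
    ultimately have "sqrt (2 * pi) ^ m / \<delta>\<^sup>2 * (W 0 * \<kappa> / 2) / (2 * pi) ^ (n + m)
        \<le> norm (restriction_op br n \<mu> (test_fun B e \<delta>) (z, t))"
      by (simp only: divide_right_mono zero_le_power mult_nonneg_nonneg pi_ge_zero zero_le_numeral)
    then show ?thesis by (simp only: times_divide_eq_left times_divide_eq_right divide_divide_eq_left mult_ac)
  qed
  show ?thesis
    by (rule that[where \<kappa> = "sqrt (2 * pi) ^ m * (W 0 * \<kappa> / 2) / (2 * pi) ^ (n + m)" and \<rho> = \<rho> and \<delta>\<^sub>0 = \<delta>\<^sub>0])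
      (use W0 \<kappa> \<rho> \<delta>0 main[unfolded \<mu>_def] in auto)
qed

end

section \<open>Norms and the comparison of exponents\<close>

text \<open>A Chebyshev estimate. Measurability of f is not assumed: otherwise
  \<open>Lp_norm\<close> is infinite by definition and the bound is trivial, so measurability of the
  restriction operator's output never has to be established.\<close>

lemma Lp_norm_lower:
  fixes f :: "'a \<Rightarrow> complex"
  assumes q: "q > 0" and A: "A \<in> sets M" "emeasure M A = ennreal v" and v: "v \<ge> 0" and c: "c \<ge> 0"
    and le: "\<And>x. x \<in> A \<Longrightarrow> c \<le> norm (f x)"
  shows "ennreal (c * v powr (1 / q)) \<le> Lp_norm M (ennreal q) f"
proof -
  define I where "I = (\<integral>\<^sup>+ x. ennreal (norm (f x) powr q) \<partial>M)"
  have "(\<integral>\<^sup>+ x. ennreal (c powr q) * indicator A x \<partial>M) \<le> I"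
    unfolding I_def
  proof (rule nn_integral_mono)
    fix x
    show "ennreal (c powr q) * indicator A x \<le> ennreal (norm (f x) powr q)"
      using le[of x] c q by (cases "x \<in> A") (auto intro!: ennreal_leI powr_mono2)
  qed
  then have I: "ennreal (c powr q * v) \<le> I"
    using A v by (simp add: nn_integral_cmult_indicator ennreal_mult)
  have "c * v powr (1 / q) \<le> enn2real I powr (1 / q)" if "I \<noteq> \<infinity>"
  proof -
    have "c powr q * v \<le> enn2real I"
      using I that v by (cases I) auto
    then have "(c powr q * v) powr (1 / q) \<le> enn2real I powr (1 / q)"
      using q v by (intro powr_mono2) auto
    then show ?thesis using q v c by (simp add: powr_mult powr_powr)
  qed
  then show ?thesis
    using q by (auto simp: Lp_norm_def Let_def I_def[symmetric] intro!: ennreal_leI)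
qed

lemma Lp_norm_test_fun:
  fixes e :: "'c::euclidean_space"
  assumes p: "p > 0" and B: "B > 0" and e: "e \<in> Basis"
  shows "\<exists>K>0. \<forall>\<delta>>0. Lp_norm lborel (ennreal p) (test_fun B e \<delta> :: 'v::euclidean_space \<times> 'c \<Rightarrow> complex)
     = ennreal ((K / \<delta> ^ (DIM('c) + 1)) powr (1 / p))"
proof -
  define K\<^sub>1 where "K\<^sub>1 = (sqrt (2 * pi) / sqrt (2 * (p * B))) ^ DIM('v)"
  define K\<^sub>2 where "K\<^sub>2 = (sqrt (2 * pi) / sqrt p) ^ DIM('c)"
  have K: "K\<^sub>1 > 0" "K\<^sub>2 > 0" using p B by (auto simp: K\<^sub>1_def K\<^sub>2_def)
  have "Lp_norm lborel (ennreal p) (test_fun B e \<delta> :: 'v \<times> 'c \<Rightarrow> complex)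
     = ennreal ((K\<^sub>1 * K\<^sub>2 / \<delta> ^ (DIM('c) + 1)) powr (1 / p))" if \<delta>: "\<delta> > 0" for \<delta>
  proof -
    have g1: "has_bochner_integral lborel (\<lambda>z::'v. exp (- (p * B * (norm z)\<^sup>2))) K\<^sub>1"
      unfolding K\<^sub>1_def using gaussian_integral[of "p * B", where 'a='v] p B by simp
    have g2: "has_bochner_integral lborel (\<lambda>t::'c. norm (wave e \<delta> t) powr p) (K\<^sub>2 / \<delta> ^ (DIM('c) + 1))"
      unfolding K\<^sub>2_def by (rule wave_powr_integral[OF e \<delta> p])
    have "has_bochner_integral lborel (\<lambda>(z, t). exp (- (p * B * (norm (z::'v))\<^sup>2)) * norm (wave e \<delta> t) powr p)
        (K\<^sub>1 * (K\<^sub>2 / \<delta> ^ (DIM('c) + 1)))"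
      using has_bochner_integral_pair_mult[of "\<lambda>z::'v. exp (- (p * B * (norm z)\<^sup>2))" "\<lambda>t. norm (wave e \<delta> t) powr p"] g1 g2
      by (simp add: has_bochner_integral_iff)
    moreover have "(\<lambda>(z, t). exp (- (p * B * (norm (z::'v))\<^sup>2)) * norm (wave e \<delta> t) powr p)
        = (\<lambda>x. norm (test_fun B e \<delta> x) powr p)"
      by (auto simp: fun_eq_iff test_fun_def norm_mult powr_mult exp_powr_real mult_ac)
    ultimately have h: "has_bochner_integral lborel (\<lambda>x::'v \<times> 'c. norm (test_fun B e \<delta> x) powr p)
        (K\<^sub>1 * K\<^sub>2 / \<delta> ^ (DIM('c) + 1))" by simp
    have "(\<integral>\<^sup>+ x. ennreal (norm (test_fun B e \<delta> x) powr p) \<partial>(lborel :: ('v \<times> 'c) measure))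
        = ennreal (K\<^sub>1 * K\<^sub>2 / \<delta> ^ (DIM('c) + 1))"
      using h by (subst nn_integral_eq_integral) (auto simp: has_bochner_integral_iff)
    moreover have "(test_fun B e \<delta> :: 'v \<times> 'c \<Rightarrow> complex) \<in> borel_measurable borel"
      unfolding test_fun_def borel_prod[symmetric] by measurable
    ultimately show ?thesis using K p \<delta> by (simp add: Lp_norm_def Let_def)
  qed
  then show ?thesis using K by (intro exI[of _ "K\<^sub>1 * K\<^sub>2"]) auto
qed

lemma emeasure_dil_box:
  fixes e :: "'c::euclidean_space"
  assumes e: "e \<in> Basis" and \<delta>: "\<delta> > 0" and \<rho>: "\<rho> > 0"
  shows "(cball 0 \<rho> \<times> {t. \<forall>b\<in>Basis. \<bar>t \<bullet> b\<bar> \<le> \<rho> / dil e \<delta> b} :: ('v::euclidean_space \<times> 'c) set) \<in> sets lborel"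
    and "emeasure lborel (cball 0 \<rho> \<times> {t. \<forall>b\<in>Basis. \<bar>t \<bullet> b\<bar> \<le> \<rho> / dil e \<delta> b} :: ('v \<times> 'c) set)
      = ennreal (measure lborel (cball (0::'v) \<rho>) * ((2 * \<rho>) ^ DIM('c) / \<delta> ^ (DIM('c) + 1)))"
proof -
  define u where "u = (\<Sum>b\<in>Basis. (\<rho> / dil e \<delta> b) *\<^sub>R b)"
  have ub: "u \<bullet> b = \<rho> / dil e \<delta> b" if "b \<in> Basis" for b using that by (simp add: u_def)
  have abs_iff: "\<bar>y\<bar> \<le> c \<longleftrightarrow> - c \<le> y \<and> y \<le> c" for y c :: real by linarith
  have box: "{t. \<forall>b\<in>Basis. \<bar>t \<bullet> b\<bar> \<le> \<rho> / dil e \<delta> b} = cbox (- u) u"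
    by (auto simp: mem_box ub abs_iff)
  show "(cball 0 \<rho> \<times> {t. \<forall>b\<in>Basis. \<bar>t \<bullet> b\<bar> \<le> \<rho> / dil e \<delta> b} :: ('v::euclidean_space \<times> 'c) set) \<in> sets lborel"
    unfolding box sets_lborel by (intro borel_closed closed_Times closed_cball closed_cbox)
  have "measure lborel (cbox (- u) u) = (\<Prod>b\<in>Basis. (u - (- u)) \<bullet> b)"
    using \<rho> dil_pos[OF \<delta>, of e] by (subst measure_lborel_cbox_eq) (auto simp: ub less_imp_le[OF divide_pos_pos])
  also have "\<dots> = (\<Prod>b\<in>Basis. 2 * \<rho> / dil e \<delta> b)"
    by (intro prod.cong refl) (simp add: inner_add_left ub)
  also have "\<dots> = (2 * \<rho>) ^ DIM('c) / \<delta> ^ (DIM('c) + 1)"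
    by (simp add: prod_dividef prod_dil[OF e])
  finally have mt: "emeasure lborel (cbox (- u) u) = ennreal ((2 * \<rho>) ^ DIM('c) / \<delta> ^ (DIM('c) + 1))"
    by (metis emeasure_eq_ennreal_measure emeasure_lborel_cbox_finite less_irrefl infinity_ennreal_def)
  have mz: "emeasure lborel (cball (0::'v) \<rho>) = ennreal (measure lborel (cball (0::'v) \<rho>))"
    by (rule emeasure_eq_ennreal_measure) (use emeasure_lborel_cball_finite[of "0::'v" \<rho>] in auto)
  have "emeasure lborel (cball 0 \<rho> \<times> cbox (- u) u :: ('v \<times> 'c) set)
      = emeasure lborel (cball (0::'v) \<rho>) * emeasure lborel (cbox (- u) u)"
    unfolding lborel_prod[symmetric] by (rule lborel.emeasure_pair_measure_Times) auto
  then show "emeasure lborel (cball 0 \<rho> \<times> {t. \<forall>b\<in>Basis. \<bar>t \<bullet> b\<bar> \<le> \<rho> / dil e \<delta> b} :: ('v \<times> 'c) set)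
      = ennreal (measure lborel (cball (0::'v) \<rho>) * ((2 * \<rho>) ^ DIM('c) / \<delta> ^ (DIM('c) + 1)))"
    unfolding box mt mz using \<rho> \<delta> by (subst ennreal_mult) auto
qed

section \<open>Comparison of exponents\<close>

lemma exponent_nonpos_of_powr_bounded:
  fixes s D x\<^sub>0 :: real
  assumes "\<And>x. x \<ge> x\<^sub>0 \<Longrightarrow> x > 0 \<Longrightarrow> x powr s \<le> D"
  shows "s \<le> 0"
proof (rule ccontr)
  assume "\<not> s \<le> 0"
  then have s: "s > 0" by simp
  define x where "x = max (max 1 x\<^sub>0) ((\<bar>D\<bar> + 1) powr (1 / s))"
  have x: "x > 0" "x \<ge> x\<^sub>0" by (auto simp: x_def)
  have "\<bar>D\<bar> + 1 = ((\<bar>D\<bar> + 1) powr (1 / s)) powr s" using s by (simp add: powr_powr)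
  also have "\<dots> \<le> x powr s" using s by (intro powr_mono2) (auto simp: x_def)
  also have "\<dots> \<le> D" using assms x by simp
  finally show False by simp
qed

text \<open>In \<open>ennreal\<close> a zero conjugate exponent is excluded because 1 / 0 is
  infinite, and an infinite one because it would force p = 1.\<close>

lemma conjugate_exponent_ennreal:
  fixes p :: real and p' :: ennreal
  assumes p: "p > 1" and conj: "1 / ennreal p + 1 / p' = 1"
  shows "\<exists>q>0. p' = ennreal q \<and> 1 / p + 1 / q = 1"
proof (cases p')
  case (real q)
  have "q > 0"
  proof (rule ccontr)
    assume "\<not> q > 0"
    then show False using real conj by simp
  qed
  have "1 / ennreal p = ennreal (1 / p)" "1 / ennreal q = ennreal (1 / q)"
    using divide_ennreal[of 1 p] divide_ennreal[of 1 q] p \<open>q > 0\<close> by simp_all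
  then have "ennreal (1 / p + 1 / q) = ennreal 1"
    using conj[unfolded real] p \<open>q > 0\<close> ennreal_plus[of "1 / p" "1 / q"] by simp
  then have "1 / p + 1 / q = 1" using p \<open>q > 0\<close> by (subst (asm) ennreal_inj) auto
  then show ?thesis using real \<open>q > 0\<close> by blast
next
  case top
  have "1 / ennreal p = ennreal (1 / p)" using p divide_ennreal[of 1 p] by simp
  then have "ennreal (1 / p) = ennreal 1" using conj top by simp
  then have "1 / p = 1" using p by (subst (asm) ennreal_inj) auto
  then show ?thesis using p by simp
qed

lemma (in central_bracket) restriction_exponent:
  assumes n: "n \<ge> 1" and p: "p > 1" and q: "q > 0" and pq: "1 / p + 1 / q = 1"
    and restriction: "\<forall>f. schwartz f \<longrightarrow>
      Lp_norm lborel (ennreal q) (restriction_op br n (real n + 1) f) \<le> ennreal C * Lp_norm lborel (ennreal p) f"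
  shows "p \<le> (2 * real DIM('c) + 2) / (real DIM('c) + 3)"
proof -
  define m where "m = real DIM('c)"
  obtain e :: 'c where e: "e \<in> Basis" using nonempty_Basis by blast
  \<comment> \<open>Any value above \<mu> = n + 1 would serve.\<close>
  define B where "B = real n + 2"
  have B1: "B > real n + 1" by (simp add: B_def)
  obtain \<kappa> \<rho> \<delta>\<^sub>0 where
    lower: "\<forall>\<delta> z t. 0 < \<delta> \<longrightarrow> \<delta> \<le> \<delta>\<^sub>0 \<longrightarrow> norm z \<le> \<rho> \<longrightarrow>
     (\<forall>b\<in>Basis. \<bar>t \<bullet> b\<bar> \<le> \<rho> / dil e \<delta> b) \<longrightarrow>
     \<kappa> / \<delta>\<^sup>2 \<le> norm (restriction_op br n (real n + 1) (test_fun B e \<delta>) (z, t))"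
    and \<kappa>: "\<kappa> > 0" and \<rho>: "\<rho> > 0" and \<delta>0: "\<delta>\<^sub>0 > 0"
    by (rule restriction_op_lower[OF n e B1], rule that)
  obtain K where K: "K > 0" and
    upper: "\<And>\<delta>. \<delta> > 0 \<Longrightarrow> Lp_norm lborel (ennreal p) (test_fun B e \<delta> :: 'v \<times> 'c \<Rightarrow> complex)
     = ennreal ((K / \<delta> ^ (DIM('c) + 1)) powr (1 / p))"
    using Lp_norm_test_fun[of p B e, where 'v='v] p e by (auto simp: B_def)
  define V where "V = measure lborel (cball (0::'v) \<rho>) * (2 * \<rho>) ^ DIM('c)"
  have V: "V > 0" unfolding V_def using \<rho> content_cball_pos[of \<rho> "0::'v"] by simp
  define s where "s = 2 + (m + 1) / q - (m + 1) / p"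
  have "x powr s \<le> \<bar>C\<bar> * K powr (1 / p) / (\<kappa> * V powr (1 / q))" if x: "x \<ge> 1 / \<delta>\<^sub>0" "x > 0" for x
  proof -
    define \<delta> where "\<delta> = 1 / x"
    have \<delta>: "\<delta> > 0" "\<delta> \<le> \<delta>\<^sub>0" using x \<delta>0 by (auto simp: \<delta>_def field_simps)
    let ?A = "cball 0 \<rho> \<times> {t. \<forall>b\<in>Basis. \<bar>t \<bullet> b\<bar> \<le> \<rho> / dil e \<delta> b} :: ('v \<times> 'c) set"
    note box = emeasure_dil_box[OF e \<delta>(1) \<rho>, where 'v='v]
    have "ennreal (\<kappa> / \<delta>\<^sup>2 * (V / \<delta> ^ (DIM('c) + 1)) powr (1 / q))
        \<le> Lp_norm lborel (ennreal q) (restriction_op br n (real n + 1) (test_fun B e \<delta>))"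
    proof (rule Lp_norm_lower[OF q box(1)])
      show "emeasure lborel ?A = ennreal (V / \<delta> ^ (DIM('c) + 1))" using box(2) by (simp add: V_def)
    qed (use V \<delta> \<kappa> lower in auto)
    also have "\<dots> \<le> ennreal C * Lp_norm lborel (ennreal p) (test_fun B e \<delta> :: 'v \<times> 'c \<Rightarrow> complex)"
      using restriction schwartz_test_fun[of B \<delta> e] \<delta> by (auto simp: B_def)
    \<comment> \<open>A negative C is truncated to 0 by \<open>ennreal\<close>; the absolute value
      makes it possible to return to real arithmetic.\<close>
    also have "\<dots> \<le> ennreal \<bar>C\<bar> * ennreal ((K / \<delta> ^ (DIM('c) + 1)) powr (1 / p))"
      unfolding upper[OF \<delta>(1)] by (intro mult_right_mono ennreal_leI) auto
    also have "\<dots> = ennreal (\<bar>C\<bar> * (K / \<delta> ^ (DIM('c) + 1)) powr (1 / p))"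
      by (simp add: ennreal_mult)
    finally have *: "\<kappa> / \<delta>\<^sup>2 * (V / \<delta> ^ (DIM('c) + 1)) powr (1 / q) \<le> \<bar>C\<bar> * (K / \<delta> ^ (DIM('c) + 1)) powr (1 / p)"
      by (simp add: ennreal_le_iff)
    have pw: "(v / \<delta> ^ (DIM('c) + 1)) powr r = v powr r * x powr ((m + 1) * r)" if "v > 0" for v r
    proof -
      have "v / \<delta> ^ (DIM('c) + 1) = v * x powr (m + 1)"
        using x by (simp add: \<delta>_def power_divide m_def powr_add powr_realpow)
      then show ?thesis using that by (simp add: powr_mult powr_powr)
    qed
    have "\<kappa> / \<delta>\<^sup>2 = \<kappa> * x powr 2" using x by (simp add: \<delta>_def power_divide powr_numeral)
    then have "\<kappa> * V powr (1 / q) * (x powr 2 * x powr ((m + 1) / q)) \<le> \<bar>C\<bar> * K powr (1 / p) * x powr ((m + 1) / p)"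
      using * pw[OF V, of "1 / q"] pw[OF K, of "1 / p"] by (simp add: mult_ac)
    then have "\<kappa> * V powr (1 / q) * (x powr 2 * x powr ((m + 1) / q)) / x powr ((m + 1) / p) \<le> \<bar>C\<bar> * K powr (1 / p)"
      using x by (simp add: divide_le_eq)
    also have "\<kappa> * V powr (1 / q) * (x powr 2 * x powr ((m + 1) / q)) / x powr ((m + 1) / p)
        = \<kappa> * V powr (1 / q) * x powr s"
      by (simp add: s_def powr_add powr_diff)
    finally show ?thesis using \<kappa> V by (simp add: field_simps)
  qed
  then have "s \<le> 0" by (rule exponent_nonpos_of_powr_bounded)
  moreover have "1 / q = 1 - 1 / p" using pq by simp
  ultimately have "2 + (m + 1) * (1 - 1 / p) - (m + 1) * (1 / p) \<le> 0"
    by (simp add: s_def divide_inverse)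
  then have "p * (2 + (m + 1) * (1 - 1 / p) - (m + 1) * (1 / p)) \<le> 0"
    using p by (intro mult_nonneg_nonpos) auto
  \<comment> \<open>The critical exponent appears here: eliminating 1 / q and clearing the
    denominator p makes the condition linear in p.\<close>
  moreover have "p * (2 + (m + 1) * (1 - 1 / p) - (m + 1) * (1 / p)) = p * (m + 3) - (2 * m + 2)"
    using p by (simp add: field_simps)
  ultimately have "p * (m + 3) \<le> 2 * m + 2" by simp
  then show ?thesis by (simp add: m_def pos_le_divide_eq)
qed

theorem mainTheorem2:
  fixes br :: "(real ^ 'd) \<times> (real ^ 'm) \<Rightarrow> (real ^ 'd) \<times> (real ^ 'm) \<Rightarrow> (real ^ 'd) \<times> (real ^ 'm)"
    and n :: nat and p :: real and p' :: ennreal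
  assumes H: "H_type br"
    and center: "lie_center br = {0} \<times> UNIV"
    and dim_z: "CARD('d) = 2 * n"
    and dim_center: "CARD('m) > 1"
    and p: "1 \<le> p" "p \<le> 2"
    and conj: "1 / ennreal p + 1 / p' = 1"
    and restriction: "\<And>\<mu>::real. \<mu> > 0 \<Longrightarrow> \<exists>C::real. \<forall>f. schwartz f \<longrightarrow>
           Lp_norm lborel p' (restriction_op br n \<mu> f) \<le> ennreal C * Lp_norm lborel (ennreal p) f"
  shows "p \<le> (2 * real CARD('m) + 2) / (real CARD('m) + 3)"
\<comment> \<open>At p = 1 the conjugate exponent is infinite and the claim is merely m + 3 \<le> 2m
  + 2; the scaling argument works with a finite conjugate exponent.\<close>
proof (cases "p = 1")
  case True
  then show ?thesis using dim_center by (simp add: field_simps)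
next
  case False
  then have p1: "p > 1" using p by simp
  interpret central_bracket br
    using H center by unfold_locales (auto simp: H_type_def lie_bracket_def two_step_nilpotent_def)
  have "n \<ge> 1" using dim_z zero_less_card_finite[where 'a='d] by linarith
  obtain q where q: "q > 0" "p' = ennreal q" "1 / p + 1 / q = 1"
    using conjugate_exponent_ennreal[OF p1 conj] by blast
  obtain C where C: "\<forall>f. schwartz f \<longrightarrow>
      Lp_norm lborel (ennreal q) (restriction_op br n (real n + 1) f) \<le> ennreal C * Lp_norm lborel (ennreal p) f"
    using restriction[of "real n + 1"] unfolding q(2) by auto
  show ?thesis
    using restriction_exponent[OF \<open>n \<ge> 1\<close> p1 q(1,3) C] by simp
qed

end
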